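(* Let $K=\mathrm{SU}(2)$ and let $\mathbf{SG}_2\subset K^2$ be the set of pairs having spectral gap. Then $\mathbf{SG}_2$ is either meager or comeager in $K^2$.
   Context: $K=\mathrm{SU}(2)$ with its normalized Haar measure. $\lambda$ denotes the left regular representation of $K$ on $L^2(K)$, $(\lambda(g)f)(h)=f(g^{-1}h)$, and $L^2_0(K)$ is the subspace of functions orthogonal to the constants. An $n$-tuple $(g_1,\dots,g_n)\in K^n$ is said to have spectral gap if there exists $\varepsilon>0$ such that for every $v\in L^2_0(K)$ there is some $k\in\{1,\dots,n\}$ with $\|\lambda(g_k)v-v\|\ge\varepsilon\|v\|$. $\mathbf{SG}_n\subset K^n$ denotes the set of $n$-tuples having spectral gap. *)

theory Defs
  imports "HOL-Probability.Probability"
begin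

type_synonym mat2 = "complex^2^2"

definition conj_transpose :: "mat2 \<Rightarrow> mat2" where
  "conj_transpose A = (\<chi> i j. cnj (A $ j $ i))"

definition SU2 :: "mat2 set" where
  "SU2 = {U. conj_transpose U ** U = mat 1 \<and> det U = 1}"

definition haar :: "mat2 measure" where
  "haar = (SOME \<mu>. sets \<mu> = sets (restrict_space borel SU2) \<and> prob_space \<mu> \<and>
      (\<forall>g\<in>SU2. \<forall>A\<in>sets \<mu>. emeasure \<mu> ((\<lambda>h. g ** h) ` A) = emeasure \<mu> A))"

definition L2 :: "(mat2 \<Rightarrow> complex) set" where
  "L2 = {f. f \<in> borel_measurable haar \<and> integrable haar (\<lambda>h. (cmod (f h))\<^sup>2)}"

definition L2_0 :: "(mat2 \<Rightarrow> complex) set" where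
  "L2_0 = {f \<in> L2. (\<integral>h. f h \<partial>haar) = 0}"

definition L2_norm :: "(mat2 \<Rightarrow> complex) \<Rightarrow> real" where
  "L2_norm f = sqrt (\<integral>h. (cmod (f h))\<^sup>2 \<partial>haar)"

definition left_reg :: "mat2 \<Rightarrow> (mat2 \<Rightarrow> complex) \<Rightarrow> (mat2 \<Rightarrow> complex)" where
  "left_reg g f = (\<lambda>h. f (matrix_inv g ** h))"

definition spectral_gap :: "mat2 list \<Rightarrow> bool" where
  "spectral_gap gs \<longleftrightarrow> (\<exists>\<epsilon>>0. \<forall>v\<in>L2_0. \<exists>k<length gs.
      L2_norm (\<lambda>h. left_reg (gs ! k) v h - v h) \<ge> \<epsilon> * L2_norm v)"

definition SG :: "nat \<Rightarrow> mat2 list set" where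
  "SG n = {gs. length gs = n \<and> set gs \<subseteq> SU2 \<and> spectral_gap gs}"

definition nowhere_dense_in :: "'a topology \<Rightarrow> 'a set \<Rightarrow> bool" where
  "nowhere_dense_in X S \<longleftrightarrow> S \<subseteq> topspace X \<and> X interior_of (X closure_of S) = {}"

definition meager_in :: "'a topology \<Rightarrow> 'a set \<Rightarrow> bool" where
  "meager_in X S \<longleftrightarrow> S \<subseteq> topspace X \<and>
     (\<exists>F. countable F \<and> (\<forall>N\<in>F. nowhere_dense_in X N) \<and> S \<subseteq> \<Union>F)"

definition comeager_in :: "'a topology \<Rightarrow> 'a set \<Rightarrow> bool" where
  "comeager_in X S \<longleftrightarrow> S \<subseteq> topspace X \<and> meager_in X (topspace X - S)"

end

theory Submission
  imports Defs "HOL-Analysis.Kronecker_Approximation_Theorem"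
begin

text \<open>
  If a pair of words in \<open>(a, b)\<close> has spectral gap, then so has \<open>(a, b)\<close>. The set of pairs with
  spectral gap is a countable union of the sets \<open>C(\<epsilon>)\<close> of pairs having gap \<open>\<epsilon>\<close>, and strong continuity
  of the regular representation confines the closure of \<open>C(\<epsilon>)\<close> to some \<open>C(\<epsilon>')\<close>. So either all
  \<open>C(\<epsilon>)\<close> are nowhere dense, or a nonempty open set \<open>U\<close> of pairs has spectral gap. In the latter case
  every pair generating a dense subgroup has two words landing in \<open>U\<close>; such pairs are dense, so the
  union of the preimages of \<open>U\<close> under all pairs of words is an open dense set of pairs with
  spectral gap.
\<close>

section \<open>The matrices in SU(2)\<close>

text \<open>The neighbourhood that strong continuity provides depends on the vector. This is
  harmless: the pair used to approximate a point of the closure of \<open>C(\<epsilon>)\<close> may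
  vary with the vector, as long as the loss in the constant does not. The return from words to the
  pair rests on a similar uniformity: displacing a vector by a product costs at most a fixed
  combination of the displacements by the factors, with a constant depending on the word alone. The
  two words are chosen independently, so density of the words' values in \<open>SU2\<close> already
  gives density of pairs of values in \<open>SU2 \<times> SU2\<close>.

  Words are products without inverses, so generation is studied through closed semigroups: the
  closure of the words' values contains a whole torus once one generator has irrational angle, and a
  second generator with two nonzero entries then fills \<open>SU2\<close>. Finally,
  \<open>haar\<close> is a choice among invariant probability measures, so such a measure has to be
  exhibited; the identification of \<open>SU2\<close> with the unit quaternions supplies
  one.\<close>

definition su :: "complex \<Rightarrow> complex \<Rightarrow> mat2" where
  "su a b = (\<chi> i j. if j = 1 then (if i = 1 then a else b) else (if i = 1 then - cnj b else cnj a))"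

lemma su_nth [simp]:
  "su a b $ 1 $ 1 = a" "su a b $ 2 $ 1 = b" "su a b $ 1 $ 2 = - cnj b" "su a b $ 2 $ 2 = cnj a"
  by (simp_all add: su_def)

lemma mat2_eq_iff:
  "(A :: 'a^2^2) = B \<longleftrightarrow> A$1$1 = B$1$1 \<and> A$1$2 = B$1$2 \<and> A$2$1 = B$2$1 \<and> A$2$2 = B$2$2"
  by (auto simp: vec_eq_iff forall_2)

lemma mat2_mult_nth:
  fixes A B :: "'a::semiring_1^2^2"
  shows "(A ** B) $ i $ j = A$i$1 * B$1$j + A$i$2 * B$2$j"
  by (simp add: matrix_matrix_mult_def sum_2)

lemma conj_transpose_nth [simp]: "conj_transpose A $ i $ j = cnj (A $ j $ i)"
  by (simp add: conj_transpose_def)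

lemma mat_1_2_nth [simp]:
  "(mat 1 :: 'a::zero_neq_one^2^2) $ 1 $ 1 = 1" "(mat 1 :: 'a^2^2) $ 2 $ 2 = 1"
  "(mat 1 :: 'a^2^2) $ 1 $ 2 = 0" "(mat 1 :: 'a^2^2) $ 2 $ 1 = 0"
  by (simp_all add: mat_def)

lemma su_mult: "su a b ** su c d = su (a * c - cnj b * d) (b * c + cnj a * d)"
  by (simp add: mat2_eq_iff mat2_mult_nth algebra_simps)

lemma conj_transpose_su: "conj_transpose (su a b) = su (cnj a) (- b)"
  by (simp add: mat2_eq_iff)

lemma su_1_0: "su 1 0 = mat 1"
  by (simp add: mat2_eq_iff)

lemma cnj_mult_self: "cnj z * z = of_real ((cmod z)\<^sup>2)" "z * cnj z = of_real ((cmod z)\<^sup>2)"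
  by (simp_all only: complex_norm_square mult.commute)

lemma su_mult_conj_transpose:
  assumes "(cmod a)\<^sup>2 + (cmod b)\<^sup>2 = 1"
  shows "su a b ** conj_transpose (su a b) = mat 1" "conj_transpose (su a b) ** su a b = mat 1"
proof -
  have "complex_of_real ((cmod a)\<^sup>2) + complex_of_real ((cmod b)\<^sup>2) = 1"
    using assms by (metis of_real_1 of_real_add)
  then show "su a b ** conj_transpose (su a b) = mat 1" "conj_transpose (su a b) ** su a b = mat 1"
    unfolding conj_transpose_su su_mult su_1_0[symmetric]
    by (simp_all add: cnj_mult_self)
qed

lemma SU2_iff: "U \<in> SU2 \<longleftrightarrow> (\<exists>a b. U = su a b \<and> (cmod a)\<^sup>2 + (cmod b)\<^sup>2 = 1)"
proof
  assume U: "U \<in> SU2"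
  then have det: "U$1$1 * U$2$2 - U$1$2 * U$2$1 = 1" and L: "conj_transpose U ** U = mat 1"
    by (auto simp: SU2_def det_2)
  \<comment> \<open>\<open>W\<close> is the adjugate of \<open>U\<close>, a right inverse because
    the determinant is 1. Since \<open>conj_transpose U\<close> is a left inverse, the two agree,
    and comparing entries gives the shape \<open>su a b\<close>.\<close>
  define W :: mat2 where
    "W = (\<chi> i j. if i = 1 then (if j = 1 then U$2$2 else - U$1$2) else (if j = 1 then - U$2$1 else U$1$1))"
  have W: "W$1$1 = U$2$2" "W$1$2 = - U$1$2" "W$2$1 = - U$2$1" "W$2$2 = U$1$1"
    by (simp_all add: W_def)
  have "U ** W = mat 1"
    using det by (simp add: mat2_eq_iff mat2_mult_nth W algebra_simps)
  then have "conj_transpose U = W"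
    by (metis L matrix_mul_assoc matrix_mul_lid matrix_mul_rid)
  then have "cnj (U$1$1) = U$2$2" "- cnj (U$2$1) = U$1$2"
    unfolding mat2_eq_iff W by auto
  then have "U = su (U$1$1) (U$2$1)"
    by (simp add: mat2_eq_iff)
  moreover have "U$1$1 * cnj (U$1$1) + cnj (U$2$1) * U$2$1 = 1"
    using det unfolding \<open>cnj (U$1$1) = U$2$2\<close> \<open>- cnj (U$2$1) = U$1$2\<close>[symmetric] by simp
  then have "of_real ((cmod (U$1$1))\<^sup>2 + (cmod (U$2$1))\<^sup>2) = (1::complex)"
    unfolding cnj_mult_self of_real_add .
  then have "(cmod (U$1$1))\<^sup>2 + (cmod (U$2$1))\<^sup>2 = 1"
    by (simp only: of_real_eq_1_iff)
  ultimately show "\<exists>a b. U = su a b \<and> (cmod a)\<^sup>2 + (cmod b)\<^sup>2 = 1"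
    by blast
next
  assume "\<exists>a b. U = su a b \<and> (cmod a)\<^sup>2 + (cmod b)\<^sup>2 = 1"
  then obtain a b where U: "U = su a b" "(cmod a)\<^sup>2 + (cmod b)\<^sup>2 = 1" by blast
  have "a * cnj a + cnj b * b = of_real ((cmod a)\<^sup>2 + (cmod b)\<^sup>2)"
    by (simp add: cnj_mult_self)
  then show "U \<in> SU2"
    using U su_mult_conj_transpose(2)[OF U(2)] by (simp add: SU2_def det_2)
qed

lemma su_in_SU2: "(cmod a)\<^sup>2 + (cmod b)\<^sup>2 = 1 \<Longrightarrow> su a b \<in> SU2"
  using SU2_iff by blast

lemma SU2_obtain_su:
  assumes "U \<in> SU2"
  obtains a b where "U = su a b" "(cmod a)\<^sup>2 + (cmod b)\<^sup>2 = 1"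
  using assms SU2_iff by blast

lemma one_in_SU2 [simp]: "mat 1 \<in> SU2"
  using su_in_SU2[of 1 0] by (simp add: su_1_0)

lemma SU2_cancel:
  assumes "U \<in> SU2"
  shows "U ** conj_transpose U = mat 1" "conj_transpose U ** U = mat 1"
  using assms su_mult_conj_transpose by (auto elim!: SU2_obtain_su)

lemma conj_transpose_in_SU2: "U \<in> SU2 \<Longrightarrow> conj_transpose U \<in> SU2"
  by (auto elim!: SU2_obtain_su simp: conj_transpose_su intro!: su_in_SU2)

lemma conj_transpose_mult: "conj_transpose (A ** B) = conj_transpose B ** conj_transpose A"
  by (simp add: mat2_eq_iff mat2_mult_nth mult.commute)

lemma SU2_mult: 
  assumes "U \<in> SU2" "V \<in> SU2" 
  shows "U ** V \<in> SU2"
proof -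
  have "conj_transpose (U ** V) ** (U ** V) = conj_transpose V ** (conj_transpose U ** U) ** V"
    by (simp add: conj_transpose_mult matrix_mul_assoc)
  also have "\<dots> = mat 1"
    using assms by (simp add: SU2_cancel)
  finally show ?thesis
    using assms by (simp add: SU2_def det_mul)
qed

lemma matrix_inv_SU2:
  assumes "U \<in> SU2"
  shows "matrix_inv U = conj_transpose U"
proof -
  have "U ** matrix_inv U = mat 1 \<and> matrix_inv U ** U = mat 1"
    unfolding matrix_inv_def by (rule someI[of _ "conj_transpose U"]) (simp add: assms SU2_cancel)
  then show ?thesis
    by (metis assms SU2_cancel(2) matrix_mul_assoc matrix_mul_lid matrix_mul_rid)
qed

lemma continuous_on_matrix_mult [continuous_intros]:
  fixes f g :: "'a::topological_space \<Rightarrow> 'b::real_normed_algebra_1^'n^'n"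
  assumes "continuous_on S f" "continuous_on S g"
  shows "continuous_on S (\<lambda>x. f x ** g x)"
  unfolding matrix_matrix_mult_def by (intro continuous_intros assms)

lemma continuous_on_conj_transpose [continuous_intros]:
  "continuous_on S f \<Longrightarrow> continuous_on S (\<lambda>x. conj_transpose (f x))"
  unfolding conj_transpose_def by (intro continuous_intros)

lemma continuous_on_su [continuous_intros]:
  assumes "continuous_on S f" "continuous_on S g"
  shows "continuous_on S (\<lambda>x. su (f x) (g x))"
proof -
  have "continuous_on S (\<lambda>x. su (f x) (g x) $ i $ j)" for i j
    by (cases "i = 1"; cases "j = 1") (auto simp: su_def intro!: continuous_intros assms)
  then have "continuous_on S (\<lambda>x. \<chi> i j. su (f x) (g x) $ i $ j)"
    by (intro continuous_on_vec_lambda)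
  then show ?thesis by simp
qed

lemma compact_SU2: "compact SU2"
proof -
  define S where "S = {p :: complex \<times> complex. (cmod (fst p))\<^sup>2 + (cmod (snd p))\<^sup>2 = 1}"
  have "closed S" unfolding S_def by (intro closed_Collect_eq continuous_intros)
  moreover have "S \<subseteq> sphere 0 1" unfolding S_def by (auto simp: norm_Pair)
  ultimately have "compact S"
    by (metis bounded_sphere bounded_subset compact_eq_bounded_closed)
  then have "compact ((\<lambda>p. su (fst p) (snd p)) ` S)"
    by (intro compact_continuous_image continuous_intros)
  moreover have "(\<lambda>p. su (fst p) (snd p)) ` S = SU2"
    unfolding S_def set_eq_iff image_iff SU2_iff by auto
  ultimately show ?thesis by simp
qed

section \<open>Haar measure from Lebesgue measure on the unit ball of quaternions\<close>

text \<open>Identifies R^4 with the quaternions, realised as the matrices \<open>su a b\<close> for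
  arbitrary complex \<open>a\<close>, \<open>b\<close>; unit vectors correspond to
  \<open>SU2\<close>.\<close>

definition quat :: "real^4 \<Rightarrow> mat2" where
  "quat x = su (Complex (x$1) (x$2)) (Complex (x$3) (x$4))"

text \<open>The formula of \<open>su_mult\<close> in four real coordinates. As a self-map of R^4,
  left multiplication comes within reach of the invariance of Lebesgue measure under orthogonal
  maps.\<close>

definition quat_mult :: "complex \<Rightarrow> complex \<Rightarrow> real^4 \<Rightarrow> real^4" where
  "quat_mult a b x = (let c = Complex (x$1) (x$2); d = Complex (x$3) (x$4);
      u = a * c - cnj b * d; v = b * c + cnj a * d
    in vector [Re u, Im u, Re v, Im v])"

text \<open>The value at 0 is a filler that keeps the map total into \<open>SU2\<close>; the ball on
  which it is used has its centre removed.\<close>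

definition radial :: "real^4 \<Rightarrow> mat2" where
  "radial x = (if x = 0 then mat 1 else quat (x /\<^sub>R norm x))"

lemma vector_4 [simp]:
  "(vector [x, y, z, w] :: 'a::zero^4) $ 1 = x" "(vector [x, y, z, w] :: 'a^4) $ 2 = y"
  "(vector [x, y, z, w] :: 'a^4) $ 3 = z" "(vector [x, y, z, w] :: 'a^4) $ 4 = w"
  by (simp_all add: vector_def)

lemma norm_vec4: "(norm (x :: real^4))\<^sup>2 = (x$1)\<^sup>2 + (x$2)\<^sup>2 + (x$3)\<^sup>2 + (x$4)\<^sup>2"
  unfolding power2_norm_eq_inner inner_vec_def sum_4 by (simp add: power2_eq_square)

lemma quat_mult: "su a b ** quat x = quat (quat_mult a b x)"
  by (simp add: quat_def quat_mult_def su_mult Let_def mat2_eq_iff complex_eq_iff)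

lemma orthogonal_transformation_quat_mult:
  assumes "(cmod a)\<^sup>2 + (cmod b)\<^sup>2 = 1"
  shows "orthogonal_transformation (quat_mult a b)"
  unfolding orthogonal_transformation
proof (intro conjI allI)
  show "linear (quat_mult a b)"
    by (rule linearI) (simp_all add: quat_mult_def Let_def vec_eq_iff forall_4 algebra_simps)
  fix x
  have "(norm (quat_mult a b x))\<^sup>2 = ((cmod a)\<^sup>2 + (cmod b)\<^sup>2) * (norm x)\<^sup>2"
    unfolding norm_vec4 quat_mult_def Let_def cmod_power2
    \<comment> \<open>Euler's four-square identity, that is, multiplicativity of the quaternion
      norm.\<close>
    by (simp, algebra)
  then show "norm (quat_mult a b x) = norm x"
    using assms by simp
qed

lemma quat_in_SU2:
  assumes "norm x = 1"
  shows "quat x \<in> SU2"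
  unfolding quat_def using norm_vec4[of x] assms
  by (intro su_in_SU2) (simp add: cmod_power2)

lemma radial_in_SU2: "radial x \<in> SU2"
  by (simp add: radial_def quat_in_SU2)

lemma radial_quat_mult:
  assumes ab: "(cmod a)\<^sup>2 + (cmod b)\<^sup>2 = 1" and x: "x \<noteq> 0"
  shows "su a b ** radial x = radial (quat_mult a b x)"
proof -
  note T = orthogonal_transformation_quat_mult[OF ab]
  have "norm (quat_mult a b x) = norm x"
    by (rule orthogonal_transformation_norm[OF T])
  then show ?thesis
    using x by (auto simp: radial_def quat_mult orthogonal_transformation_scaleR[OF T])
qed

lemma continuous_on_Complex [continuous_intros]:
  "continuous_on S f \<Longrightarrow> continuous_on S g \<Longrightarrow> continuous_on S (\<lambda>x. Complex (f x) (g x))"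
  by (simp add: Complex_eq continuous_intros)

lemma radial_measurable: "radial \<in> borel_measurable borel"
proof (rule borel_measurable_continuous_countable_exceptions)
  have "continuous_on (- {0}) (\<lambda>x. quat (x /\<^sub>R norm x))"
    unfolding quat_def by (intro continuous_intros) auto
  then show "continuous_on (- {0}) radial"
    by (rule continuous_on_eq) (simp add: radial_def)
qed simp

lemma SU2_borel [measurable]: "SU2 \<in> sets borel"
  using compact_SU2 by (simp add: borel_closed compact_imp_closed)

lemma continuous_on_translate: "continuous_on S (\<lambda>h. g ** h)" for g :: mat2 and S :: "mat2 set"
  by (rule continuous_on_matrix_mult[OF continuous_on_const continuous_on_id])

lemma translate_eq_vimage:
  assumes g: "g \<in> SU2" and A: "A \<subseteq> SU2"
  shows "(\<lambda>h. g ** h) ` A = (\<lambda>h. conj_transpose g ** h) -` A \<inter> SU2"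
proof -
  have *: "conj_transpose g ** (g ** h) = h" "g ** (conj_transpose g ** h) = h" for h
    by (simp_all add: matrix_mul_assoc SU2_cancel g)
  show ?thesis
    using A by (auto simp: * SU2_mult g image_iff) (metis *(2))
qed

text \<open>The measure of a set is the proportion of the unit ball of R^4 filled by the cone over
  it. Left translation by \<open>g\<close> extends to an orthogonal map of R^4, which carries the
  cone over \<open>A\<close> to the cone over its translate and preserves Lebesgue measure.\<close>

lemma haar_exists:
  "\<exists>\<mu>. sets \<mu> = sets (restrict_space borel SU2) \<and> prob_space \<mu> \<and>
      (\<forall>g\<in>SU2. \<forall>A\<in>sets \<mu>. emeasure \<mu> ((\<lambda>h. g ** h) ` A) = emeasure \<mu> A)"
proof -
  define D where "D = ball (0::real^4) 1 - {0}"
  define \<nu> where "\<nu> = uniform_measure lborel D"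
  define \<mu> where "\<mu> = distr \<nu> (restrict_space borel SU2) radial"
  have D: "D \<in> sets borel" by (simp add: D_def)
  have "emeasure lborel D = emeasure lborel (ball (0::real^4) 1)"
    unfolding D_def by (subst emeasure_Diff_null_set) auto
  moreover have "emeasure lborel (ball (0::real^4) 1) \<noteq> 0"
    using open_not_negligible[of "ball (0::real^4) 1"]
    by (auto simp: negligible_iff_null_sets null_sets_def)
  moreover have fin: "emeasure lborel (ball (0::real^4) 1) \<noteq> \<infinity>"
    using emeasure_bounded_finite[OF bounded_ball, of "0::real^4" 1] by simp
  ultimately have D0: "emeasure lborel D \<noteq> 0" "emeasure lborel D \<noteq> \<infinity>"
    by simp_all
  interpret \<nu>: prob_space \<nu>
    unfolding \<nu>_def using D0 by (rule prob_space_uniform_measure)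
  have rad [measurable]: "radial \<in> measurable \<nu> (restrict_space borel SU2)"
    by (rule measurable_restrict_space2)
       (use radial_measurable radial_in_SU2 in \<open>auto simp: \<nu>_def\<close>)
  have "prob_space \<mu>"
    unfolding \<mu>_def by (rule \<nu>.prob_space_distr) measurable
  moreover have sets: "sets \<mu> = sets (restrict_space borel SU2)"
    by (simp add: \<mu>_def)
  moreover have "emeasure \<mu> ((\<lambda>h. g ** h) ` A) = emeasure \<mu> A" if g: "g \<in> SU2" and A: "A \<in> sets \<mu>" for g A
  proof -
    obtain a b where ab: "g = su a b" "(cmod a)\<^sup>2 + (cmod b)\<^sup>2 = 1"
      using g by (rule SU2_obtain_su)
    note T = orthogonal_transformation_quat_mult[OF ab(2)]
    have A': "A \<subseteq> SU2" "A \<in> sets borel"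
      using A unfolding sets by (auto simp: sets_restrict_space)
    have gA: "(\<lambda>h. g ** h) ` A \<in> sets borel"
    proof -
      have "(\<lambda>h::mat2. conj_transpose g ** h) \<in> borel_measurable borel"
        by (intro borel_measurable_continuous_onI continuous_on_translate)
      from measurable_sets[OF this A'(2)] show ?thesis
        unfolding translate_eq_vimage[OF g A'(1)] by auto
    qed
    have rB: "radial -` B \<in> sets borel" if "B \<in> sets borel" for B
      using measurable_sets[OF radial_measurable that] by simp
    have mu: "emeasure \<mu> B = emeasure lebesgue (D \<inter> radial -` B) / emeasure lborel D"
      if "B \<subseteq> SU2" "B \<in> sets borel" for B
    proof -
      have "B \<in> sets (restrict_space borel SU2)"
        using that by (auto simp: sets_restrict_space_iff)
      then have "emeasure \<mu> B = emeasure \<nu> (radial -` B)"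
        unfolding \<mu>_def using rad by (subst emeasure_distr) (auto simp: \<nu>_def)
      then show ?thesis
        unfolding \<nu>_def using rB[OF that(2)] D by (simp add: emeasure_uniform_measure)
    qed
    have eq: "quat_mult a b ` (D \<inter> radial -` A) = D \<inter> radial -` ((\<lambda>h. g ** h) ` A)"
    proof (intro equalityI subsetI)
      fix y assume "y \<in> quat_mult a b ` (D \<inter> radial -` A)"
      then obtain x where x: "y = quat_mult a b x" "x \<in> D" "radial x \<in> A" by auto
      have "norm y = norm x" using x(1) orthogonal_transformation_norm[OF T] by simp
      with x(2) have "y \<in> D" by (auto simp: D_def)
      moreover have "radial y = g ** radial x"
        using x radial_quat_mult[OF ab(2)] by (auto simp: D_def ab(1))
      ultimately show "y \<in> D \<inter> radial -` ((\<lambda>h. g ** h) ` A)" using x(3) by auto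
    next
      fix y assume y: "y \<in> D \<inter> radial -` ((\<lambda>h. g ** h) ` A)"
      obtain x where x: "y = quat_mult a b x"
        using orthogonal_transformation_surj[OF T] by (metis surjD)
      have "norm y = norm x" using x(1) orthogonal_transformation_norm[OF T] by simp
      with y have xD: "x \<in> D" by (auto simp: D_def)
      then have "radial y = g ** radial x"
        using x radial_quat_mult[OF ab(2)] by (auto simp: D_def ab(1))
      then obtain h where h: "h \<in> A" "g ** radial x = g ** h" using y by auto
      then have "radial x = h"
        by (metis SU2_cancel(2)[OF g] matrix_mul_assoc matrix_mul_lid)
      with h xD x show "y \<in> quat_mult a b ` (D \<inter> radial -` A)" by auto
    qed
    have lm: "D \<inter> radial -` A \<in> lmeasurable"
      by (rule bounded_set_imp_lmeasurable)
         (use D rB[OF A'(2)] in \<open>auto simp: D_def intro: bounded_subset[OF bounded_ball[of 0 1]]\<close>)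
    have "quat_mult a b ` (D \<inter> radial -` A) \<in> lmeasurable"
         "measure lebesgue (quat_mult a b ` (D \<inter> radial -` A)) = measure lebesgue (D \<inter> radial -` A)"
      using T lm by (auto intro: measurable_orthogonal_image measure_orthogonal_image)
    then have "emeasure lebesgue (D \<inter> radial -` ((\<lambda>h. g ** h) ` A)) = emeasure lebesgue (D \<inter> radial -` A)"
      using lm unfolding eq by (simp add: emeasure_eq_measure2 fmeasurableD2)
    moreover have "(\<lambda>h. g ** h) ` A \<subseteq> SU2" using A'(1) g SU2_mult by auto
    ultimately show ?thesis
      using mu A' gA by simp
  qed
  ultimately show ?thesis by blast
qed

text \<open>The cone construction ends here: \<open>haar\<close> is a choice among all measures with
  these three properties, so only the properties carry over.\<close>

lemma sets_haar: "sets haar = sets (restrict_space borel SU2)"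
  and prob_space_haar: "prob_space haar"
  and emeasure_haar_translate:
    "g \<in> SU2 \<Longrightarrow> A \<in> sets haar \<Longrightarrow> emeasure haar ((\<lambda>h. g ** h) ` A) = emeasure haar A"
  using someI_ex[OF haar_exists] unfolding haar_def[symmetric] by blast+

lemma space_haar: "space haar = SU2"
  using sets_eq_imp_space_eq[OF sets_haar] by (simp add: space_restrict_space)

lemma translate_measurable_haar:
  assumes g: "g \<in> SU2"
  shows "(\<lambda>h. g ** h) \<in> measurable haar haar"
proof -
  have "(\<lambda>h. g ** h) \<in> measurable (restrict_space borel SU2) (restrict_space borel SU2)"
    by (intro measurable_restrict_space2 measurable_restrict_space1 borel_measurable_continuous_onI continuous_on_translate)
       (auto simp: space_restrict_space SU2_mult g)
  then show ?thesis
    by (simp cong: measurable_cong_sets add: sets_haar)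
qed

text \<open>Integrals transform under pushforwards, whereas invariance is given for images of sets.
  The preimage under translation by \<open>g\<close> is the image under translation by its inverse,
  so invariance is applied to \<open>conj_transpose g\<close>.\<close>

lemma distr_haar_translate:
  assumes g: "g \<in> SU2"
  shows "distr haar haar (\<lambda>h. g ** h) = haar"
proof (rule measure_eqI)
  fix A assume "A \<in> sets (distr haar haar (\<lambda>h. g ** h))"
  then have A: "A \<in> sets haar" by simp
  then have AS: "A \<subseteq> SU2" using sets.sets_into_space space_haar by blast
  have g': "conj_transpose g \<in> SU2" using g by (rule conj_transpose_in_SU2)
  have "emeasure (distr haar haar (\<lambda>h. g ** h)) A = emeasure haar ((\<lambda>h. g ** h) -` A \<inter> SU2)"
    using A translate_measurable_haar[OF g] by (simp add: emeasure_distr space_haar)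
  also have "(\<lambda>h. g ** h) -` A \<inter> SU2 = (\<lambda>h. conj_transpose g ** h) ` A"
    using translate_eq_vimage[OF g' AS] by (simp add: conj_transpose_def vec_eq_iff vec_nth_inverse)
  finally show "emeasure (distr haar haar (\<lambda>h. g ** h)) A = emeasure haar A"
    using emeasure_haar_translate[OF g' A] by simp
qed simp

lemma integral_haar_translate:
  fixes f :: "mat2 \<Rightarrow> 'a::{banach, second_countable_topology}"
  assumes g: "g \<in> SU2" and f: "f \<in> borel_measurable haar"
  shows "(\<integral>h. f (g ** h) \<partial>haar) = (\<integral>h. f h \<partial>haar)"
  using integral_distr[OF translate_measurable_haar[OF g] f] by (simp add: distr_haar_translate[OF g])

lemma integrable_haar_translate:
  fixes f :: "mat2 \<Rightarrow> 'a::{banach, second_countable_topology}"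
  assumes g: "g \<in> SU2" and f: "integrable haar f"
  shows "integrable haar (\<lambda>h. f (g ** h))"
  using integrable_distr[OF translate_measurable_haar[OF g], of f] f by (simp add: distr_haar_translate[OF g])

section \<open>Strong continuity of the left regular representation\<close>

text \<open>Squared norms make every estimate linear in integrals; square roots return only when the
  gap condition is translated in \<open>SG_2_iff\<close>.\<close>

definition L2sq :: "(mat2 \<Rightarrow> complex) \<Rightarrow> real" where
  "L2sq f = (\<integral>h. (cmod (f h))\<^sup>2 \<partial>haar)"

lemma L2_norm_L2sq: "L2_norm f = sqrt (L2sq f)"
  by (simp add: L2_norm_def L2sq_def)

lemma L2sq_nonneg [simp]: "0 \<le> L2sq f"
  by (simp add: L2sq_def)

text \<open>Replaces Minkowski's inequality throughout: the constants are irrelevant for a spectral gap.\<close>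
lemma norm_add_sq_le:
  fixes a b :: "'a::real_normed_vector"
  shows "(norm (a + b))\<^sup>2 \<le> 2 * (norm a)\<^sup>2 + 2 * (norm b)\<^sup>2"
proof -
  have "(norm (a + b))\<^sup>2 \<le> (norm a + norm b)\<^sup>2"
    by (simp add: norm_triangle_ineq power_mono)
  also have "\<dots> \<le> 2 * (norm a)\<^sup>2 + 2 * (norm b)\<^sup>2"
    using sum_squares_bound[of "norm a" "norm b"] by (simp add: power2_sum)
  finally show ?thesis .
qed

lemma L2_measurable: "f \<in> L2 \<Longrightarrow> f \<in> borel_measurable haar"
  and L2_integrable: "f \<in> L2 \<Longrightarrow> integrable haar (\<lambda>h. (cmod (f h))\<^sup>2)"
  by (auto simp: L2_def)

lemma L2_I_bound:
  assumes f: "f \<in> borel_measurable haar" and g: "integrable haar g"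
    and le: "\<And>h. h \<in> SU2 \<Longrightarrow> (cmod (f h))\<^sup>2 \<le> g h"
  shows "f \<in> L2" "L2sq f \<le> (\<integral>h. g h \<partial>haar)"
proof -
  have int: "integrable haar (\<lambda>h. (cmod (f h))\<^sup>2)"
    by (rule Bochner_Integration.integrable_bound[OF g])
       (use f le in \<open>auto simp: space_haar intro!: AE_I2 order_trans[OF le]\<close>)
  then show "f \<in> L2" using f by (simp add: L2_def)
  show "L2sq f \<le> (\<integral>h. g h \<partial>haar)"
    unfolding L2sq_def by (rule integral_mono[OF int g]) (simp add: le space_haar)
qed

lemma
  assumes "f \<in> L2" "g \<in> L2"
  shows L2_add: "(\<lambda>h. f h + g h) \<in> L2"
    and L2sq_add_le: "L2sq (\<lambda>h. f h + g h) \<le> 2 * L2sq f + 2 * L2sq g"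
proof -
  have "integrable haar (\<lambda>h. 2 * (cmod (f h))\<^sup>2 + 2 * (cmod (g h))\<^sup>2)"
    using assms by (intro Bochner_Integration.integrable_add integrable_mult_right L2_integrable)
  note * = L2_I_bound[OF _ this norm_add_sq_le]
  show "(\<lambda>h. f h + g h) \<in> L2"
    by (intro * borel_measurable_add L2_measurable assms)
  have "L2sq (\<lambda>h. f h + g h) \<le> (\<integral>h. 2 * (cmod (f h))\<^sup>2 + 2 * (cmod (g h))\<^sup>2 \<partial>haar)"
    by (intro * borel_measurable_add L2_measurable assms)
  also have "\<dots> = 2 * L2sq f + 2 * L2sq g"
    using assms by (simp add: L2sq_def L2_integrable)
  finally show "L2sq (\<lambda>h. f h + g h) \<le> 2 * L2sq f + 2 * L2sq g" .
qed

lemma L2_uminus: "f \<in> L2 \<Longrightarrow> (\<lambda>h. - f h) \<in> L2"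
  by (auto simp: L2_def)

lemma L2_diff: "f \<in> L2 \<Longrightarrow> g \<in> L2 \<Longrightarrow> (\<lambda>h. f h - g h) \<in> L2"
  using L2_add[OF _ L2_uminus] by simp

lemma L2sq_diff_commute: "L2sq (\<lambda>h. f h - g h) = L2sq (\<lambda>h. g h - f h)"
  by (simp add: L2sq_def norm_minus_commute)

lemma left_reg_SU2: "g \<in> SU2 \<Longrightarrow> left_reg g f = (\<lambda>h. f (conj_transpose g ** h))"
  by (simp add: left_reg_def matrix_inv_SU2)

lemma
  assumes g: "g \<in> SU2" and f: "f \<in> L2"
  shows left_reg_L2: "left_reg g f \<in> L2"
    and L2sq_left_reg: "L2sq (left_reg g f) = L2sq f"
proof -
  note g' = conj_transpose_in_SU2[OF g]
  note m = measurable_compose[OF translate_measurable_haar[OF g']]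
  show "left_reg g f \<in> L2"
    using m[OF L2_measurable[OF f]] integrable_haar_translate[OF g' L2_integrable[OF f]]
    by (simp add: L2_def left_reg_SU2[OF g])
  show "L2sq (left_reg g f) = L2sq f"
    using integral_haar_translate[OF g' borel_measurable_integrable[OF L2_integrable[OF f]]]
    by (simp add: L2sq_def left_reg_SU2[OF g])
qed

lemma left_reg_mult: "g \<in> SU2 \<Longrightarrow> k \<in> SU2 \<Longrightarrow> left_reg (g ** k) f = left_reg g (left_reg k f)"
  by (simp add: left_reg_SU2 SU2_mult conj_transpose_mult matrix_mul_assoc)

lemma left_reg_diff: "left_reg g (\<lambda>h. u h - v h) = (\<lambda>h. left_reg g u h - left_reg g v h)"
  by (simp add: left_reg_def)

text \<open>Cocycle identity: \<lambda>(gk)v - v is the sum of \<lambda>(g)(\<lambda>(k)v - v) and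
  \<lambda>(g)v - v, and \<lambda>(g) is isometric.\<close>

lemma L2sq_left_reg_mult_le:
  assumes "g \<in> SU2" "k \<in> SU2" "v \<in> L2"
  shows "L2sq (\<lambda>h. left_reg (g ** k) v h - v h)
    \<le> 2 * L2sq (\<lambda>h. left_reg g v h - v h) + 2 * L2sq (\<lambda>h. left_reg k v h - v h)"
proof -
  have d: "(\<lambda>h. left_reg k v h - v h) \<in> L2" "(\<lambda>h. left_reg g v h - v h) \<in> L2"
    using assms by (auto intro: L2_diff left_reg_L2)
  have "(\<lambda>h. left_reg (g ** k) v h - v h)
      = (\<lambda>h. left_reg g (\<lambda>h. left_reg k v h - v h) h + (left_reg g v h - v h))"
    using assms by (simp add: left_reg_mult left_reg_diff)
  then show ?thesis
    using L2sq_add_le[OF left_reg_L2[OF assms(1) d(1)] d(2)] L2sq_left_reg[OF assms(1) d(1)] by simp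
qed

section \<open>Density of the continuous functions in L^2(K)\<close>

lemma continuous_measurable_haar:
  fixes f :: "mat2 \<Rightarrow> 'a::topological_space"
  assumes "continuous_on UNIV f"
  shows "f \<in> borel_measurable haar"
  using measurable_restrict_space1[OF borel_measurable_continuous_onI[OF assms]]
  by (simp cong: measurable_cong_sets add: sets_haar)

lemma continuous_L2:
  assumes "continuous_on UNIV f"
  shows "f \<in> L2"
proof -
  interpret prob_space haar by (rule prob_space_haar)
  have "compact (f ` SU2)"
    using assms by (intro compact_continuous_image compact_SU2) (auto intro: continuous_on_subset)
  then obtain B where B: "\<And>h. h \<in> SU2 \<Longrightarrow> cmod (f h) \<le> B"
    by (metis bounded_iff compact_imp_bounded image_eqI)
  show ?thesis
    by (rule L2_I_bound(1)[where g = "\<lambda>_. B\<^sup>2"])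
       (auto intro: continuous_measurable_haar assms power_mono B)
qed

text \<open>The approximants are continuous on the whole matrix space, not just on
  \<open>SU2\<close>, so composing them with matrix products stays continuous without side
  conditions.\<close>

definition L2_approx :: "(mat2 \<Rightarrow> complex) \<Rightarrow> bool" where
  "L2_approx v \<longleftrightarrow> v \<in> L2 \<and> (\<forall>e>0. \<exists>f. continuous_on UNIV f \<and> L2sq (\<lambda>h. v h - f h) < e)"

lemma L2_approx_add:
  assumes u: "L2_approx u" and v: "L2_approx v"
  shows "L2_approx (\<lambda>h. u h + v h)"
  unfolding L2_approx_def
proof (intro conjI allI impI)
  show "(\<lambda>h. u h + v h) \<in> L2" using u v by (auto simp: L2_approx_def intro: L2_add)
  fix e :: real assume "e > 0"
  then have "e/4 > 0" by simp
  with u v obtain f g where fg: "continuous_on UNIV f" "L2sq (\<lambda>h. u h - f h) < e/4"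
      "continuous_on UNIV g" "L2sq (\<lambda>h. v h - g h) < e/4"
    unfolding L2_approx_def by meson
  have "L2sq (\<lambda>h. (u h - f h) + (v h - g h)) \<le> 2 * L2sq (\<lambda>h. u h - f h) + 2 * L2sq (\<lambda>h. v h - g h)"
    using u v fg(1,3)[THEN continuous_L2] by (intro L2sq_add_le L2_diff) (auto simp: L2_approx_def)
  also have "\<dots> < e" using fg by simp
  finally have "L2sq (\<lambda>h. u h + v h - (f h + g h)) < e" by (simp add: algebra_simps)
  then show "\<exists>f. continuous_on UNIV f \<and> L2sq (\<lambda>h. u h + v h - f h) < e"
    using fg by (intro exI[of _ "\<lambda>h. f h + g h"]) (auto intro: continuous_intros)
qed

text \<open>Regularity squeezes \<open>B\<close> between a compact \<open>K\<close> and an open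
  \<open>U\<close> with \<open>U - K\<close> of small measure. A Urysohn function equal to
  \<open>c\<close> on \<open>K\<close> and 0 off \<open>U\<close> differs from the target only on
  \<open>U - K\<close>, by at most \<open>cmod c\<close>.\<close>

lemma L2_approx_indicator:
  assumes B: "B \<in> sets haar"
  shows "L2_approx (\<lambda>h. indicator B h *\<^sub>R c)"
  unfolding L2_approx_def
proof (intro conjI allI impI)
  interpret prob_space haar by (rule prob_space_haar)
  show in_L2: "(\<lambda>h. indicator B h *\<^sub>R c) \<in> L2"
    by (rule L2_I_bound(1)[where g = "\<lambda>_. (cmod c)\<^sup>2"])
       (use B in \<open>auto simp: indicator_def\<close>)
  fix e :: real assume e: "e > 0"
  \<comment> \<open>Regularity is available for Borel measures on the whole type, while
    \<open>haar\<close> lives on \<open>SU2\<close>; hence the pushforward under inclusion.\<close>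
  define M where "M = distr haar borel (\<lambda>h. h)"
  have id: "(\<lambda>h. h) \<in> measurable haar borel"
    by (rule continuous_measurable_haar) simp
  interpret M: prob_space M
    unfolding M_def by (rule prob_space_distr[OF id])
  have sM: "sets M = sets borel" by (simp add: M_def)
  have Bb: "B \<in> sets borel" "B \<subseteq> SU2"
    using B by (auto simp: sets_haar sets_restrict_space)
  \<comment> \<open>The error will be below \<open>(cmod c)\<^sup>2 * (2 * d)\<close>; the added 1
    covers \<open>c = 0\<close>.\<close>
  define d where "d = e / 2 / ((cmod c)\<^sup>2 + 1)"
  have pos: "(cmod c)\<^sup>2 + 1 > 0" by (simp add: add_nonneg_pos)
  then have d: "d > 0" using e by (simp add: d_def)
  have "\<exists>K. K \<subseteq> B \<and> compact K \<and> M.prob B - d < M.prob K"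
  proof -
    \<comment> \<open>\<open>ennreal\<close> truncates negative reals to 0, so the strict inequality
      can fail when \<open>B\<close> is null. In the second case the empty set serves as
      \<open>K\<close>.\<close>
    have "ennreal (M.prob B - d) < emeasure M B \<or> M.prob B - d < 0"
      using d by (auto simp: M.emeasure_eq_measure intro!: ennreal_lessI)
    then show ?thesis
    proof
      assume "ennreal (M.prob B - d) < emeasure M B"
      also have "\<dots> = (SUP K \<in> {K. K \<subseteq> B \<and> compact K}. emeasure M K)"
        using Bb by (intro inner_regular sM) auto
      finally obtain K where "K \<subseteq> B" "compact K" "ennreal (M.prob B - d) < emeasure M K"
        unfolding less_SUP_iff by auto
      then show ?thesis 
        unfolding M.emeasure_eq_measure by (metis ennreal_leI not_less)
    qed (auto intro!: exI[of _ "{}"])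
  qed
  then obtain K where K: "K \<subseteq> B" "compact K" "M.prob B - d < M.prob K" by blast
  have "emeasure M B < ennreal (M.prob B + d)"
    using d by (auto simp: M.emeasure_eq_measure intro!: ennreal_lessI add_nonneg_pos)
  moreover have "emeasure M B = (INF U \<in> {U. B \<subseteq> U \<and> open U}. emeasure M U)"
    using Bb by (intro outer_regular sM) auto
  ultimately obtain U where "B \<subseteq> U" "open U" "emeasure M U < ennreal (M.prob B + d)"
    by (auto simp: INF_less_iff)
  then have U: "B \<subseteq> U" "open U" "M.prob U < M.prob B + d"
    unfolding M.emeasure_eq_measure by (auto, metis ennreal_leI not_less)
  have KU: "K \<in> sets borel" "U \<in> sets borel"
    using K U by (auto intro: borel_closed compact_imp_closed)
  have "M.prob (U - K) = M.prob U - M.prob K"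
    using K U KU by (intro M.finite_measure_Diff) (auto simp: sM)
  then have UK: "M.prob (U - K) < 2 * d" using K U by simp
  obtain f :: "mat2 \<Rightarrow> complex" where f: "continuous_on UNIV f"
      "\<And>x. f x \<in> closed_segment c 0" "\<And>x. x \<in> K \<Longrightarrow> f x = c" "\<And>x. x \<in> - U \<Longrightarrow> f x = 0"
    using Urysohn[of K "- U" c 0] K U by (auto simp: compact_imp_closed)
  have UKh: "(U - K) \<inter> SU2 \<in> sets haar"
    using KU by (auto simp: sets_haar sets_restrict_space)
  have "L2sq (\<lambda>h. indicator B h *\<^sub>R c - f h) \<le> (\<integral>h. (cmod c)\<^sup>2 * indicator ((U - K) \<inter> SU2) h \<partial>haar)"
  proof (rule L2_I_bound(2))
    show "(\<lambda>h. indicator B h *\<^sub>R c - f h) \<in> borel_measurable haar"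
      by (intro borel_measurable_diff L2_measurable in_L2 continuous_measurable_haar f(1))
    show "integrable haar (\<lambda>h. (cmod c)\<^sup>2 * indicator ((U - K) \<inter> SU2) h)"
      using UKh by (auto simp: emeasure_eq_measure)
    fix h assume h: "h \<in> SU2"
    obtain t where t: "0 \<le> t" "t \<le> 1" "f h = (1 - t) *\<^sub>R c"
      using f(2)[of h] by (auto simp: closed_segment_def)
    have "cmod (indicator B h *\<^sub>R c - f h) \<le> cmod c * indicator ((U - K) \<inter> SU2) h"
    proof (cases "h \<in> U - K")
      case True
      have "c - f h = t *\<^sub>R c" using t by (simp add: algebra_simps)
      then have "cmod (indicator B h *\<^sub>R c - f h) \<le> cmod c"
        using t by (cases "h \<in> B") (auto simp: mult_left_le_one_le)
      then show ?thesis using True h by simp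
    next
      case False
      then have "indicator B h *\<^sub>R c - f h = 0"
        using f K U by (cases "h \<in> K") (auto simp: subset_iff indicator_def)
      then show ?thesis by simp
    qed
    moreover have indicator_sq: "(indicator ((U - K) \<inter> SU2) h :: real)\<^sup>2 = indicator ((U - K) \<inter> SU2) h"
      by (simp add: indicator_def)
    ultimately have "(cmod (indicator B h *\<^sub>R c - f h))\<^sup>2 \<le> (cmod c * indicator ((U - K) \<inter> SU2) h)\<^sup>2"
      by (intro power_mono) auto
    then show "(cmod (indicator B h *\<^sub>R c - f h))\<^sup>2 \<le> (cmod c)\<^sup>2 * indicator ((U - K) \<inter> SU2) h"
      by (simp only: power_mult_distrib indicator_sq)
  qed
  also have "\<dots> = (cmod c)\<^sup>2 * prob ((U - K) \<inter> SU2)"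
    using UKh by simp
  also have "prob ((U - K) \<inter> SU2) = M.prob (U - K)"
    unfolding M_def using KU by (subst measure_distr[OF id]) (auto simp: space_haar)
  also have "(cmod c)\<^sup>2 * M.prob (U - K) \<le> (cmod c)\<^sup>2 * (2 * d)"
    using UK by (intro mult_left_mono) auto
  also have "\<dots> < ((cmod c)\<^sup>2 + 1) * (2 * d)"
    using d by simp
  also have "\<dots> = e"
  proof -
    have "2 * (e / 2 / q) = e / q" for q by simp
    then have "2 * d = e / ((cmod c)\<^sup>2 + 1)" unfolding d_def .
    then show ?thesis using pos by (metis less_irrefl nonzero_mult_div_cancel_left times_divide_eq_right)
  qed
  finally show "\<exists>f. continuous_on UNIV f \<and> L2sq (\<lambda>h. indicator B h *\<^sub>R c - f h) < e"
    using f(1) by blast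
qed

lemma L2_approx_sum:
  assumes "finite I" "\<And>i. i \<in> I \<Longrightarrow> L2_approx (v i)"
  shows "L2_approx (\<lambda>h. \<Sum>i\<in>I. v i h)"
  using assms
proof (induction I)
  case empty
  then show ?case using L2_approx_indicator[of "{}" 0] by simp
next
  case (insert i I)
  then show ?case by (simp add: L2_approx_add)
qed

text \<open>Needed because a simple function agrees with its sum of indicators only on
  \<open>SU2\<close>: the indicators vanish outside, the function may not.\<close>

lemma L2_approx_cong:
  assumes v: "L2_approx v" and eq: "\<And>h. h \<in> SU2 \<Longrightarrow> u h = v h"
  shows "L2_approx u"
proof -
  have "u \<in> L2 \<longleftrightarrow> v \<in> L2"
    using measurable_cong[of haar u v borel] eq
      Bochner_Integration.integrable_cong[OF refl, of haar "\<lambda>h. (cmod (u h))\<^sup>2" "\<lambda>h. (cmod (v h))\<^sup>2"]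
    by (simp add: L2_def space_haar)
  moreover have "L2sq (\<lambda>h. u h - f h) = L2sq (\<lambda>h. v h - f h)" for f
    unfolding L2sq_def by (rule Bochner_Integration.integral_cong) (auto simp: eq space_haar)
  ultimately show ?thesis using v by (simp add: L2_approx_def)
qed

lemma L2_approx_simple:
  assumes s: "simple_function haar s"
  shows "L2_approx s"
proof (rule L2_approx_cong)
  show "L2_approx (\<lambda>h. \<Sum>y\<in>s ` space haar. indicator (s -` {y} \<inter> space haar) h *\<^sub>R y)"
    using s by (intro L2_approx_sum L2_approx_indicator) (auto simp: simple_function_def)
  fix h assume "h \<in> SU2"
  then have h: "h \<in> space haar" by (simp add: space_haar)
  have "(\<Sum>y\<in>s ` space haar. indicator (s -` {y} \<inter> space haar) h *\<^sub>R y)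
      = (\<Sum>y\<in>s ` space haar. if y = s h then y else 0)"
    using h by (intro sum.cong) (auto simp: indicator_def)
  also have "\<dots> = s h"
    using s h by (simp add: simple_function_def)
  finally show "s h = (\<Sum>y\<in>s ` space haar. indicator (s -` {y} \<inter> space haar) h *\<^sub>R y)" by simp
qed

lemma L2_continuous_dense:
  assumes v: "v \<in> L2" and e: "e > 0"
  shows "\<exists>f. continuous_on UNIV f \<and> L2sq (\<lambda>h. v h - f h) < e"
proof -
  obtain s where s: "\<And>i. simple_function haar (s i)"
    and lim: "\<And>h. h \<in> SU2 \<Longrightarrow> (\<lambda>i. s i h) \<longlonglongrightarrow> v h"
    and bd: "\<And>i h. h \<in> SU2 \<Longrightarrow> cmod (s i h) \<le> 2 * cmod (v h)"
    using borel_measurable_implies_sequence_metric[OF L2_measurable[OF v], of 0]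
    by (simp add: space_haar) blast
  have meas: "s i \<in> borel_measurable haar" for i
    using s by (rule borel_measurable_simple_function)
  have "(\<lambda>i. L2sq (\<lambda>h. v h - s i h)) \<longlonglongrightarrow> (\<integral>h. (0::real) \<partial>haar)"
    unfolding L2sq_def
  \<comment> \<open>The factor 9 is the square of 1 + 2, since the simple functions are bounded by
    \<open>2 * cmod (v h)\<close>.\<close>
  proof (rule integral_dominated_convergence[where w = "\<lambda>h. 9 * (cmod (v h))\<^sup>2"])
    show "(\<lambda>h. (cmod (v h - s i h))\<^sup>2) \<in> borel_measurable haar" for i
      using meas L2_measurable[OF v] by measurable
    show "integrable haar (\<lambda>h. 9 * (cmod (v h))\<^sup>2)"
      using v by (auto intro: L2_integrable)
    show "AE h in haar. (\<lambda>i. (cmod (v h - s i h))\<^sup>2) \<longlonglongrightarrow> 0"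
    proof (rule AE_I2)
      fix h assume "h \<in> space haar"
      then have "(\<lambda>i. (cmod (v h - s i h))\<^sup>2) \<longlonglongrightarrow> (cmod (v h - v h))\<^sup>2"
        by (intro tendsto_intros lim) (simp add: space_haar)
      then show "(\<lambda>i. (cmod (v h - s i h))\<^sup>2) \<longlonglongrightarrow> 0" by simp
    qed
    show "AE h in haar. norm ((cmod (v h - s i h))\<^sup>2) \<le> 9 * (cmod (v h))\<^sup>2" for i
    proof (rule AE_I2)
      fix h assume "h \<in> space haar"
      then have "cmod (v h - s i h) \<le> 3 * cmod (v h)"
        using norm_triangle_ineq4[of "v h" "s i h"] bd[of h i] by (simp add: space_haar)
      then have "(cmod (v h - s i h))\<^sup>2 \<le> (3 * cmod (v h))\<^sup>2"
        by (rule power_mono) simp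
      then show "norm ((cmod (v h - s i h))\<^sup>2) \<le> 9 * (cmod (v h))\<^sup>2"
        by (simp add: power_mult_distrib)
    qed
  qed simp
  then have "eventually (\<lambda>i. L2sq (\<lambda>h. v h - s i h) < e/4) sequentially"
    using e by (intro order_tendstoD) auto
  then obtain i where i: "L2sq (\<lambda>h. v h - s i h) < e/4"
    by (auto simp: eventually_sequentially)
  have A: "L2_approx (s i)" by (rule L2_approx_simple[OF s])
  then obtain f where f: "continuous_on UNIV f" "L2sq (\<lambda>h. s i h - f h) < e/4"
    using e unfolding L2_approx_def by (meson divide_pos_pos zero_less_numeral)
  have "L2sq (\<lambda>h. (v h - s i h) + (s i h - f h)) \<le> 2 * L2sq (\<lambda>h. v h - s i h) + 2 * L2sq (\<lambda>h. s i h - f h)"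
    using A v f(1)[THEN continuous_L2] by (intro L2sq_add_le L2_diff) (auto simp: L2_approx_def)
  also have "\<dots> < e" using i f by simp
  finally show ?thesis using f(1) by auto
qed

text \<open>Replace \<open>v\<close> by a continuous \<open>f\<close>: the two replacement errors do
  not depend on the group element because translation is isometric, and for \<open>f\<close> uniform
  continuity on the compact \<open>SU2 \<times> SU2\<close> bounds the difference simultaneously for
  all \<open>h\<close>.\<close>

lemma left_reg_strongly_continuous:
  assumes v: "v \<in> L2" and g0: "g0 \<in> SU2" and e: "e > 0"
  obtains d where "d > 0"
    "\<And>g. g \<in> SU2 \<Longrightarrow> dist g g0 < d \<Longrightarrow> L2sq (\<lambda>h. left_reg g v h - left_reg g0 v h) < e"
proof -
  interpret prob_space haar by (rule prob_space_haar)
  \<comment> \<open>With errors e/12, e/16, e/12, applying the quadratic estimate twice gives e/3 +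
    e/4 + e/6, which is below \<open>e\<close>.\<close>
  obtain f where f: "continuous_on UNIV f" and vf: "L2sq (\<lambda>h. v h - f h) < e/12"
    using L2_continuous_dense[OF v, of "e/12"] e by auto
  note fL2 = continuous_L2[OF f]
  define \<eta> where "\<eta> = sqrt (e / 16)"
  have \<eta>: "\<eta> > 0" "\<eta>\<^sup>2 = e / 16" using e by (simp_all add: \<eta>_def)
  have "continuous_on (SU2 \<times> SU2) (\<lambda>p. f (conj_transpose (fst p) ** snd p))"
    by (intro continuous_on_compose2[OF f] continuous_on_matrix_mult continuous_on_conj_transpose
          continuous_on_fst continuous_on_snd continuous_on_id) auto
  then have "uniformly_continuous_on (SU2 \<times> SU2) (\<lambda>p. f (conj_transpose (fst p) ** snd p))"
    by (rule compact_uniformly_continuous) (simp add: compact_Times compact_SU2)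
  then obtain d where d: "d > 0" and du: "\<And>p q. p \<in> SU2 \<times> SU2 \<Longrightarrow> q \<in> SU2 \<times> SU2 \<Longrightarrow> dist q p < d \<Longrightarrow>
      dist (f (conj_transpose (fst q) ** snd q)) (f (conj_transpose (fst p) ** snd p)) < \<eta>"
    unfolding uniformly_continuous_on_def using \<eta>(1) by meson
  show thesis
  proof
    show "d > 0" by (rule d)
    fix g assume g: "g \<in> SU2" "dist g g0 < d"
    let ?a = "left_reg g (\<lambda>h. v h - f h)"
    let ?b = "\<lambda>h. left_reg g f h - left_reg g0 f h"
    let ?c = "left_reg g0 (\<lambda>h. f h - v h)"
    have L2: "?a \<in> L2" "?b \<in> L2" "?c \<in> L2"
      using g g0 v fL2 by (auto intro!: left_reg_L2 L2_diff)
    have a: "L2sq ?a < e/12" and c: "L2sq ?c < e/12"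
      using vf L2sq_left_reg[OF g(1) L2_diff[OF v fL2]] L2sq_left_reg[OF g0 L2_diff[OF fL2 v]]
      by (simp_all add: L2sq_diff_commute[of f v])
    have "L2sq ?b \<le> (\<integral>h. \<eta>\<^sup>2 \<partial>haar)"
    proof (rule L2_I_bound(2)[OF L2_measurable[OF L2(2)]])
      fix h assume "h \<in> SU2"
      then have "dist (left_reg g f h) (left_reg g0 f h) < \<eta>"
        using du[of "(g0, h)" "(g, h)"] g g0 by (simp add: left_reg_SU2 dist_Pair_Pair)
      then show "(cmod (?b h))\<^sup>2 \<le> \<eta>\<^sup>2"
        by (intro power_mono) (auto simp: dist_norm)
    qed simp
    then have b: "L2sq ?b \<le> e/16" using \<eta> by (simp add: prob_space)
    have "L2sq (\<lambda>h. (?a h + ?b h) + ?c h) \<le> 2 * (2 * L2sq ?a + 2 * L2sq ?b) + 2 * L2sq ?c"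
      using L2sq_add_le[OF L2_add[OF L2(1,2)] L2(3)] L2sq_add_le[OF L2(1,2)] by simp
    also have "\<dots> < e" using a b c e by simp
    finally show "L2sq (\<lambda>h. left_reg g v h - left_reg g0 v h) < e"
      by (simp add: left_reg_diff)
  qed
qed

section \<open>Pairs generating a dense subgroup\<close>

lemma su_in_SU2_iff: "su a b \<in> SU2 \<longleftrightarrow> (cmod a)\<^sup>2 + (cmod b)\<^sup>2 = 1"
proof
  assume "su a b \<in> SU2"
  then obtain c d where "su a b = su c d" "(cmod c)\<^sup>2 + (cmod d)\<^sup>2 = 1"
    by (rule SU2_obtain_su)
  then show "(cmod a)\<^sup>2 + (cmod b)\<^sup>2 = 1" by (simp add: mat2_eq_iff)
qed (rule su_in_SU2)

lemma cis_add_2pi_frac: "cis (c + 2 * pi * frac y) = cis (c + 2 * pi * y)"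
proof -
  have "cis (c + 2 * pi * y) = cis (c + 2 * pi * frac y) * cis (2 * pi * of_int \<lfloor>y\<rfloor>)"
    by (simp add: cis_mult frac_def algebra_simps)
  then show ?thesis by (simp add: cis_multiple_2pi)
qed

lemma cis_eq_times:
  assumes "cmod a = cmod b"
  obtains p where "b = cis p * a"
proof
  have "b = cmod b * cis (Arg b)" "a = cmod a * cis (Arg a)"
    using rcis_cmod_Arg by (auto simp: rcis_def)
  then show "b = cis (Arg b - Arg a) * a"
    by (metis assms cis_mult diff_add_cancel mult.left_commute)
qed

section \<open>Closed semigroups containing an irrational rotation\<close>

context
  fixes H :: "mat2 set" and t :: real
  assumes closed: "closed H"
    and mult: "\<And>x y. x \<in> H \<Longrightarrow> y \<in> H \<Longrightarrow> x ** y \<in> H"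
    and rot: "su (cis t) 0 \<in> H" and irrat: "t / (2 * pi) \<notin> \<rat>"
begin

lemma torus_subset: "su (cis s) 0 \<in> H"
proof -
  \<comment> \<open>The offset \<open>t\<close> makes \<open>f 0\<close> the given rotation: only
    positive powers of it are known to lie in \<open>H\<close>, so the orbit starts at exponent 1.
    Density of the fractional parts then covers all angles.\<close>
  define f where "f x = su (cis (t + 2 * pi * x)) 0" for x
  define \<theta> where "\<theta> = t / (2 * pi)"
  have f_multiple: "su (cis (t + real n * t)) 0 \<in> H" for n
  proof (induction n)
    case (Suc n)
    have "su (cis t) 0 ** su (cis (t + real n * t)) 0 = su (cis (t + real (Suc n) * t)) 0"
      by (simp add: su_mult cis_mult algebra_simps)
    then show ?case using mult[OF rot Suc] by simp
  qed (simp add: rot)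
  have "f (frac (real n * \<theta>)) \<in> H" for n
    using f_multiple[of n] unfolding f_def cis_add_2pi_frac by (simp add: \<theta>_def)
  then have "f ` range (\<lambda>n. frac (real n * \<theta>)) \<subseteq> H" by auto
  then have "f ` closure (range (\<lambda>n. frac (real n * \<theta>))) \<subseteq> H"
    by (intro image_closure_subset closed)
       (auto simp: f_def intro!: continuous_intros continuous_on_su continuous_on_cis)
  then have "f ` {0..1} \<subseteq> H"
    using Kronecker_approx_1[of \<theta>] irrat unfolding \<theta>_def[symmetric] by simp
  moreover have "frac ((s - t) / (2 * pi)) \<in> {0..1}"
    by (simp add: frac_ge_0 less_imp_le[OF frac_lt_1])
  ultimately have "f (frac ((s - t) / (2 * pi))) \<in> H" by blast
  then show ?thesis unfolding f_def cis_add_2pi_frac by simp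
qed

lemma su_in_if_cmod_eq:
  assumes ab: "su a b \<in> H" and eq: "cmod a = cmod c" "cmod b = cmod d"
  shows "su c d \<in> H"
proof -
  obtain p q where pq: "c = cis p * a" "d = cis q * b"
    using eq by (metis cis_eq_times)
  \<comment> \<open>Multiplying by torus elements with angles \<open>x\<close> on the left and
    \<open>y\<close> on the right turns the first entry by \<open>x + y\<close> and the second by
    \<open>y - x\<close>. These are the solutions for prescribed \<open>p\<close> and
    \<open>q\<close>.\<close>
  define x y where "x = (p - q) / 2" and "y = (p + q) / 2"
  have xy: "cis x * cis y = cis p" "cis y * cis (- x) = cis q"
    by (simp_all add: cis_mult x_def y_def field_simps)
  have "su (cis x) 0 ** su a b ** su (cis y) 0 = su (cis x * cis y * a) (cis y * cis (- x) * b)"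
    by (simp add: su_mult cis_cnj mult_ac)
  also have "\<dots> = su c d"
    by (simp only: xy pq)
  finally show ?thesis
    using mult[OF mult[OF torus_subset ab] torus_subset] by metis
qed

lemma SU2_subset_if_generic:
  assumes ab: "su a b \<in> H" "(cmod a)\<^sup>2 + (cmod b)\<^sup>2 = 1" "a \<noteq> 0" "b \<noteq> 0"
  shows "SU2 \<subseteq> H"
proof -
  txt \<open>As \<open>H\<close> contains the diagonal torus, membership of \<open>su c d\<close> in \<open>H\<close> depends only on \<open>cmod c\<close>.
    If the value \<open>r = cos x\<close> occurs, so do all values between \<open>\<bar>cos (2 x)\<bar>\<close> and 1; iterating, all
    values in \<open>[0, 1]\<close> occur.\<close>
  define Q where "Q r \<longleftrightarrow> (\<forall>c d. su c d \<in> SU2 \<and> cmod c = r \<longrightarrow> su c d \<in> H)" for r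
  have Q_I: "Q (cmod c)" if "su c d \<in> H" "su c d \<in> SU2" for c d
    unfolding Q_def
  proof (intro allI impI)
    fix c' d' assume *: "su c' d' \<in> SU2 \<and> cmod c' = cmod c"
    have "(cmod c)\<^sup>2 + (cmod d)\<^sup>2 = 1" "(cmod c)\<^sup>2 + (cmod d')\<^sup>2 = 1"
      using that * by (auto simp: su_in_SU2_iff)
    then have "(cmod d)\<^sup>2 = (cmod d')\<^sup>2" by linarith
    then have "cmod d = cmod d'" by simp
    then show "su c' d' \<in> H" using su_in_if_cmod_eq[OF that(1)] * by metis
  qed
  have double: "Q r'" if r: "Q r" "0 \<le> r" "r \<le> 1" and r': "\<bar>2 * r\<^sup>2 - 1\<bar> \<le> r'" "r' \<le> 1" for r r'
  proof -
    define s where "s = sqrt (1 - r\<^sup>2)"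
    have "r\<^sup>2 \<le> 1" using r by (simp add: power_le_one)
    then have s: "s\<^sup>2 = 1 - r\<^sup>2" by (simp add: s_def)
    \<comment> \<open>The modulus of the first entry of \<open>su r s ** su r (s * cis u)\<close>.
      Both factors have first entry \<open>r\<close>, and turning the phase \<open>u\<close> from 0
      to \<pi> moves the modulus continuously from \<open>\<bar>2 * r\<^sup>2 - 1\<bar>\<close> to
      1.\<close>
    define f where "f u = cmod (of_real (r\<^sup>2) - of_real (s\<^sup>2) * cis u)" for u
    have f0: "f 0 = \<bar>2 * r\<^sup>2 - 1\<bar>"
    proof -
      have "f 0 = cmod (of_real (r\<^sup>2 - s\<^sup>2))" by (simp add: f_def)
      also have "\<dots> = \<bar>r\<^sup>2 - s\<^sup>2\<bar>" by (rule norm_of_real)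
      finally show ?thesis by (simp add: s)
    qed
    have fpi: "f pi = 1"
    proof -
      have "f pi = cmod (of_real (r\<^sup>2 + s\<^sup>2))" by (simp add: f_def)
      also have "\<dots> = 1" by (simp add: s)
      finally show ?thesis .
    qed
    have "\<exists>u\<ge>0. u \<le> pi \<and> f u = r'"
      by (rule IVT') (use r' f0 fpi in \<open>auto simp: f_def intro!: continuous_intros continuous_on_cis\<close>)
    then obtain u where u: "f u = r'" by blast
    have SU: "su (of_real r) (of_real s) \<in> SU2" "su (of_real r) (of_real s * cis u) \<in> SU2"
      using s by (simp_all add: su_in_SU2_iff norm_mult)
    then have "su (of_real r) (of_real s) \<in> H" "su (of_real r) (of_real s * cis u) \<in> H"
      using r unfolding Q_def by auto
    then have "su (of_real r) (of_real s) ** su (of_real r) (of_real s * cis u) \<in> H" by (rule mult)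
    moreover have "su (of_real r) (of_real s) ** su (of_real r) (of_real s * cis u)
        = su (of_real (r\<^sup>2) - of_real (s\<^sup>2) * cis u) (of_real s * of_real r + of_real r * (of_real s * cis u))"
      by (simp add: su_mult power2_eq_square mult.assoc)
    ultimately show "Q r'"
      using Q_I SU2_mult[OF SU] u unfolding f_def by metis
  qed
  define \<delta> where "\<delta> = 1 - \<bar>2 * (cmod a)\<^sup>2 - 1\<bar>"
  have "0 < (cmod a)\<^sup>2" "0 < (cmod b)\<^sup>2" using ab by simp_all
  then have \<delta>: "\<delta> > 0" using ab(2) unfolding \<delta>_def by linarith
  have "cmod a \<le> 1"
    using ab(2) by (metis abs_norm_cancel abs_square_le_1 le_add_same_cancel1 zero_le_power2)
  then have base: "Q r" if "1 - \<delta> \<le> r" "r \<le> 1" for r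
    using that double[of "cmod a" r] Q_I[OF ab(1)] ab(2) by (simp add: \<delta>_def su_in_SU2_iff)
  have "\<forall>r. 0 \<le> r \<and> r \<le> 1 \<and> 1 - 2 ^ n * \<delta> \<le> r \<longrightarrow> Q r" for n
  proof (induction n)
    case 0
    then show ?case using base by simp
  next
    case (Suc n)
    show ?case
    proof (intro allI impI, elim conjE)
      fix r :: real assume r: "0 \<le> r" "r \<le> 1" "1 - 2 ^ Suc n * \<delta> \<le> r"
      \<comment> \<open>\<open>sqrt x\<close> is the half-angle cosine for \<open>r\<close>, so
        doubling it returns \<open>r\<close>. The distance \<open>1 - x\<close> is half of
        \<open>1 - r\<close>, and \<open>sqrt x\<close> is at least \<open>x\<close>, so the
        previous stage covers it.\<close>
      define x where "x = (1 + r) / 2"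
      have x: "0 \<le> x" "x \<le> 1" "1 - 2 ^ n * \<delta> \<le> x" using r by (auto simp: x_def field_simps)
      have "x\<^sup>2 \<le> x" using x by (simp add: power2_eq_square mult_left_le)
      then have "x \<le> sqrt x" by (rule real_le_rsqrt)
      with x Suc have Qx: "Q (sqrt x)" by auto
      have "2 * x - 1 = r" by (simp add: x_def field_simps)
      then have "2 * (sqrt x)\<^sup>2 - 1 = r" using x by simp
      then show "Q r"
        using x r by (intro double[OF Qx]) simp_all
    qed
  qed
  moreover obtain n where "1 / \<delta> < 2 ^ n"
    using real_arch_pow[of 2 "1 / \<delta>"] by auto
  then have "1 \<le> 2 ^ n * \<delta>" using \<delta> by (simp add: field_simps)
  ultimately have Q: "Q r" if "0 \<le> r" "r \<le> 1" for r using that by (meson diff_le_0_iff_le order_trans)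
  show ?thesis
  proof
    fix U assume U: "U \<in> SU2"
    then obtain c d where cd: "U = su c d" "(cmod c)\<^sup>2 + (cmod d)\<^sup>2 = 1" by (rule SU2_obtain_su)
    have "cmod c \<le> 1"
      using cd(2) by (metis abs_norm_cancel abs_square_le_1 le_add_same_cancel1 zero_le_power2)
    with Q[of "cmod c"] U cd show "U \<in> H" by (auto simp: Q_def)
  qed
qed

end

section \<open>Perturbing a pair so that its words become dense\<close>

lemma SU2_diagonalize:
  assumes "g \<in> SU2"
  obtains k s where "k \<in> SU2" "g = k ** su (cis s) 0 ** conj_transpose k"
proof -
  obtain a b where g: "g = su a b" and ab: "(cmod a)\<^sup>2 + (cmod b)\<^sup>2 = 1"
    using assms by (rule SU2_obtain_su)
  txt \<open>For \<open>b \<noteq> 0\<close>, the vector \<open>(cis s - cnj a, b)\<close> is an eigenvector for the eigenvalue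
    \<open>cis s\<close>, where \<open>2 cos s\<close> is the trace.\<close>
  show thesis
  proof (cases "b = 0")
    case True
    then have "cmod a = 1" using ab by (simp add: power2_eq_1_iff) (smt (verit) norm_ge_zero)
    then have "a = cis (Arg a)" by (metis mult_1 of_real_1 rcis_cmod_Arg rcis_def)
    then have "g = su (cis (Arg a)) 0" using g True by simp
    moreover have "conj_transpose (mat 1) = mat 1" by (simp add: mat2_eq_iff)
    ultimately show thesis using that[OF one_in_SU2, of "Arg a"] by simp
  next
    case False
    define s where "s = arccos (Re a)"
    have "(Re a)\<^sup>2 \<le> 1" using ab by (simp add: cmod_power2) (smt (verit) zero_le_power2)
    then have "cos s = Re a" unfolding s_def by (intro cos_arccos_abs) (simp add: abs_square_le_1)
    then have tr: "a + cnj a = cis s + cnj (cis s)" by (simp add: complex_eq_iff)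
    define v where "v = cis s - cnj a"
    \<comment> \<open>The first row of the eigenvector equation amounts to the characteristic
      equation: \<open>cis s\<close> is a root of z^2 - (a + cnj a) z + 1, the constant term being
      the determinant.\<close>
    have "a * v - cnj b * b = (a + cnj a) * cis s - cis s * cis s - (a * cnj a + cnj b * b) + v * cis s"
      by (simp add: v_def algebra_simps)
    also have "a * cnj a + cnj b * b = of_real ((cmod a)\<^sup>2 + (cmod b)\<^sup>2)"
      by (simp add: cnj_mult_self)
    also have "\<dots> = 1" by (simp add: ab)
    also have "(a + cnj a) * cis s = cis s * cis s + 1"
      unfolding tr by (simp add: algebra_simps cis_cnj cis_mult)
    finally have e1: "a * v - cnj b * b = v * cis s" by simp
    have e2: "b * v + cnj a * b = b * cis s" by (simp add: v_def algebra_simps)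
    define N where "N = sqrt ((cmod v)\<^sup>2 + (cmod b)\<^sup>2)"
    have N2: "N\<^sup>2 = (cmod v)\<^sup>2 + (cmod b)\<^sup>2" by (simp add: N_def)
    have N: "N > 0" using False by (simp add: N_def add_nonneg_pos)
    define k where "k = su (v / N) (b / N)"
    have k: "k \<in> SU2"
      using False N N2 unfolding k_def su_in_SU2_iff
      by (simp add: norm_divide power_divide flip: add_divide_distrib)
    have "g ** k = su ((a * v - cnj b * b) / N) ((b * v + cnj a * b) / N)"
      by (simp add: g k_def su_mult diff_divide_distrib add_divide_distrib)
    also have "\<dots> = k ** su (cis s) 0" unfolding e1 e2 by (simp add: k_def su_mult)
    finally have "g ** k ** conj_transpose k = k ** su (cis s) 0 ** conj_transpose k" by simp
    then show thesis
      using that k by (simp add: SU2_cancel flip: matrix_mul_assoc)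
  qed
qed

text \<open>Nonempty products of the two generators, without inverses. A word is a function of the
  pair, so that one word can be evaluated at varying pairs and its continuity stated.\<close>

inductive_set words :: "(mat2 \<times> mat2 \<Rightarrow> mat2) set" where
  "fst \<in> words"
| "snd \<in> words"
| "w \<in> words \<Longrightarrow> z \<in> words \<Longrightarrow> (\<lambda>p. w p ** z p) \<in> words"

lemma words_continuous: "w \<in> words \<Longrightarrow> continuous_on S w"
  by (induction rule: words.induct)
     (simp_all add: continuous_on_matrix_mult continuous_on_fst continuous_on_snd continuous_on_id)

lemma words_SU2: "w \<in> words \<Longrightarrow> p \<in> SU2 \<times> SU2 \<Longrightarrow> w p \<in> SU2"
  by (induction rule: words.induct) (auto simp: SU2_mult)

lemma closure_words_mult:
  assumes "x \<in> closure ((\<lambda>w. w p) ` words)" "y \<in> closure ((\<lambda>w. w p) ` words)"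
  shows "x ** y \<in> closure ((\<lambda>w. w p) ` words)"
proof -
  let ?G = "(\<lambda>w. w p) ` words"
  have "(\<lambda>q. fst q ** snd q) ` closure (?G \<times> ?G) \<subseteq> closure ?G"
  proof (rule image_closure_subset)
    have "w p ** z p \<in> ?G" if "w \<in> words" "z \<in> words" for w z
      using words.intros(3)[OF that] by (rule image_eqI[rotated]) simp
    then have "(\<lambda>q. fst q ** snd q) ` (?G \<times> ?G) \<subseteq> ?G" by auto
    then show "(\<lambda>q. fst q ** snd q) ` (?G \<times> ?G) \<subseteq> closure ?G"
      by (rule order_trans[OF _ closure_subset])
  qed (auto intro!: continuous_on_matrix_mult continuous_on_fst continuous_on_snd continuous_on_id)
  then show ?thesis
    using assms by (force simp: closure_Times)
qed

text \<open>If one entry vanishes, the other has modulus 1. Replacing the zero by sin s and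
  multiplying the other entry by cos s stays in \<open>SU2\<close>, and for small positive s both
  entries are nonzero.\<close>

lemma generic_perturbation:
  assumes g: "g \<in> SU2" and B: "open B" "g \<in> B"
  obtains a b where "su a b \<in> SU2" "su a b \<in> B" "a \<noteq> 0" "b \<noteq> 0"
proof -
  obtain a b where ab: "g = su a b" "(cmod a)\<^sup>2 + (cmod b)\<^sup>2 = 1"
    using g by (rule SU2_obtain_su)
  have path: "\<exists>s. 0 < s \<and> s < pi / 2 \<and> su (f s) (h s) \<in> B"
    if "continuous_on UNIV f" "continuous_on UNIV h" "f 0 = a" "h 0 = b" for f h :: "real \<Rightarrow> complex"
  proof -
    have "continuous_on UNIV (\<lambda>s. su (f s) (h s))" using that by (intro continuous_on_su)
    then have "((\<lambda>s. su (f s) (h s)) \<longlongrightarrow> su (f 0) (h 0)) (at 0)"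
      by (simp add: continuous_on_def)
    then have "((\<lambda>s. su (f s) (h s)) \<longlongrightarrow> su (f 0) (h 0)) (at_right 0)"
      by (rule tendsto_within_subset) simp
    then have "eventually (\<lambda>s. su (f s) (h s) \<in> B) (at_right 0)"
      by (rule topological_tendstoD) (use B ab that in auto)
    moreover have "eventually (\<lambda>s. s \<in> {0<..<pi/2}) (at_right (0::real))"
      by (rule eventually_at_right_real) simp
    ultimately have "eventually (\<lambda>s. su (f s) (h s) \<in> B \<and> s \<in> {0<..<pi/2}) (at_right 0)"
      by (rule eventually_conj)
    then obtain s where "su (f s) (h s) \<in> B \<and> s \<in> {0<..<pi/2}"
      by (metis (mono_tags, lifting) eventually_happens trivial_limit_at_right_real)
    then show ?thesis by auto
  qed
  have sin_cont: "continuous_on UNIV (\<lambda>s. of_real (sin s) :: complex)"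
    and cos_cont: "continuous_on UNIV (\<lambda>s. z * of_real (cos s) :: complex)" for z
    by (intro continuous_intros)+
  have trig: "sin s \<noteq> 0" "cos s \<noteq> 0" if "0 < s" "s < pi / 2" for s
    using that sin_gt_zero[of s] cos_gt_zero[of s] by auto
  consider "a \<noteq> 0" "b \<noteq> 0" | "a = 0" "cmod b = 1" | "b = 0" "cmod a = 1"
    using ab(2) by (cases "a = 0"; cases "b = 0") (auto simp: abs_square_eq_1)
  then show thesis
  proof cases
    case 1
    then show thesis using that g B ab by auto
  next
    case 2
    obtain s where "0 < s" "s < pi / 2" "su (of_real (sin s)) (b * of_real (cos s)) \<in> B"
      using path[OF sin_cont cos_cont[of b]] 2 by auto
    with trig[of s] 2 show thesis
      by (intro that[of "of_real (sin s)" "b * of_real (cos s)"]) (auto simp: su_in_SU2_iff norm_mult)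
  next
    case 3
    obtain s where "0 < s" "s < pi / 2" "su (a * of_real (cos s)) (of_real (sin s)) \<in> B"
      using path[OF cos_cont[of a] sin_cont] 3 by auto
    with trig[of s] 3 show thesis
      by (intro that[of "a * of_real (cos s)" "of_real (sin s)"]) (auto simp: su_in_SU2_iff norm_mult)
  qed
qed

text \<open>In coordinates diagonalizing \<open>a0\<close>, move its angle slightly to an irrational
  multiple of 2\<pi>, and perturb \<open>b0\<close> so that both entries are nonzero. Conjugating
  back gives the pair.\<close>

lemma topologically_generating_pairs_dense:
  assumes a0: "a0 \<in> SU2" "a0 \<in> A" "open A" and b0: "b0 \<in> SU2" "b0 \<in> B" "open B"
  obtains a b where "a \<in> SU2" "a \<in> A" "b \<in> SU2" "b \<in> B"
    "SU2 \<subseteq> closure ((\<lambda>w. w (a, b)) ` words)"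
proof -
  obtain k s0 where k: "k \<in> SU2" and a0k: "a0 = k ** su (cis s0) 0 ** conj_transpose k"
    using a0(1) by (rule SU2_diagonalize)
  define c where "c x = k ** x ** conj_transpose k" for x
  have c_cont: "continuous_on UNIV c"
    unfolding c_def by (intro continuous_on_matrix_mult continuous_on_const continuous_on_id)
  have c_SU2: "c x \<in> SU2" if "x \<in> SU2" for x
    using that k by (simp add: c_def SU2_mult conj_transpose_in_SU2)
  have c_mult: "c (x ** y) = c x ** c y" for x y
  proof -
    have "c x ** c y = k ** x ** (conj_transpose k ** k) ** y ** conj_transpose k"
      by (simp add: c_def matrix_mul_assoc)
    then show ?thesis by (simp add: SU2_cancel k c_def matrix_mul_assoc)
  qed
  have c_inv: "c (conj_transpose k ** x ** k) = x" for x
  proof -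
    have "c (conj_transpose k ** x ** k) = (k ** conj_transpose k) ** x ** (k ** conj_transpose k)"
      by (simp add: c_def matrix_mul_assoc)
    then show ?thesis by (simp add: SU2_cancel k)
  qed
  have "open ((\<lambda>s. c (su (cis s) 0)) -` A)"
    by (intro open_vimage a0 continuous_on_compose2[OF c_cont] continuous_on_su continuous_on_cis
        continuous_on_id continuous_on_const) auto
  moreover have "s0 \<in> (\<lambda>s. c (su (cis s) 0)) -` A" using a0 a0k by (simp add: c_def)
  \<comment> \<open>The admissible angles form a nonempty open set of reals, which no countable set
    of bad angles can exhaust.\<close>
  moreover have "countable ((\<lambda>x. 2 * pi * x) ` \<rat>)" by (simp add: countable_rat)
  ultimately obtain s where s: "c (su (cis s) 0) \<in> A" "s \<notin> (\<lambda>x. 2 * pi * x) ` \<rat>"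
    using open_minus_countable by (metis empty_iff vimageD)
  have irrat: "s / (2 * pi) \<notin> \<rat>"
  proof
    assume "s / (2 * pi) \<in> \<rat>"
    then have "2 * pi * (s / (2 * pi)) \<in> (\<lambda>x. 2 * pi * x) ` \<rat>" by (rule imageI)
    with s(2) show False by simp
  qed
  have "conj_transpose k ** b0 ** k \<in> SU2"
    using k b0 by (simp add: SU2_mult conj_transpose_in_SU2)
  moreover have "open (c -` B)" using b0 c_cont by (intro open_vimage)
  moreover have "conj_transpose k ** b0 ** k \<in> c -` B" using b0 by (simp add: c_inv)
  ultimately obtain p q where pq: "su p q \<in> SU2" "su p q \<in> c -` B" "p \<noteq> 0" "q \<noteq> 0"
    by (rule generic_perturbation)
  define a b where "a = c (su (cis s) 0)" and "b = c (su p q)"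
  have ab: "a \<in> SU2" "a \<in> A" "b \<in> SU2" "b \<in> B"
    using s pq by (auto simp: a_def b_def c_SU2 su_in_SU2_iff)
  let ?G = "(\<lambda>w. w (a, b)) ` words"
  have "a \<in> ?G" "b \<in> ?G" 
    using image_eqI[OF _ words.intros(1), of a "\<lambda>w. w (a, b)"]
      image_eqI[OF _ words.intros(2), of b "\<lambda>w. w (a, b)"] by simp_all
  then have ab_cl: "a \<in> closure ?G" "b \<in> closure ?G"
    by (simp_all only: subsetD[OF closure_subset])
  \<comment> \<open>Conjugation \<open>c\<close> is a continuous homomorphism, so the preimage of
    the closed semigroup is again a closed semigroup, now containing a diagonal rotation.\<close>
  have "SU2 \<subseteq> c -` closure ?G"
  proof (rule SU2_subset_if_generic[OF _ _ _ irrat])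
    show "closed (c -` closure ?G)" using c_cont by (intro closed_vimage) auto
    show "x ** y \<in> c -` closure ?G" if "x \<in> c -` closure ?G" "y \<in> c -` closure ?G" for x y
      using that by (simp add: c_mult closure_words_mult)
    show "su (cis s) 0 \<in> c -` closure ?G" "su p q \<in> c -` closure ?G"
      using ab_cl by (simp_all add: a_def b_def)
  qed (use pq in \<open>simp_all add: su_in_SU2_iff\<close>)
  then have cl: "c x \<in> closure ?G" if "x \<in> SU2" for x
    using that by blast
  have "SU2 \<subseteq> closure ?G"
  proof
    fix x assume "x \<in> SU2"
    then have "conj_transpose k ** x ** k \<in> SU2"
      using k by (simp add: SU2_mult conj_transpose_in_SU2)
    from cl[OF this] show "x \<in> closure ?G" by (simp only: c_inv)
  qed
  with ab show thesis by (rule that)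
qed

section \<open>Spectral gap of pairs\<close>

definition displacement :: "mat2 \<Rightarrow> (mat2 \<Rightarrow> complex) \<Rightarrow> real" where
  "displacement g v = L2sq (\<lambda>h. left_reg g v h - v h)"

text \<open>The sets \<open>C(\<epsilon>)\<close> with the inequality squared: \<open>e\<close>
  stands for the square of the gap constant. The maximum encodes that one of the two elements moves
  \<open>v\<close> enough.\<close>

definition gap_pairs :: "real \<Rightarrow> (mat2 \<times> mat2) set" where
  "gap_pairs e = {p \<in> SU2 \<times> SU2. \<forall>v\<in>L2_0. e * L2sq v \<le> max (displacement (fst p) v) (displacement (snd p) v)}"

lemma displacement_nonneg: "0 \<le> displacement g v"
  by (simp add: displacement_def)

lemma L2_0_L2: "v \<in> L2_0 \<Longrightarrow> v \<in> L2"
  by (simp add: L2_0_def)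

lemma SG_2_iff: "[a, b] \<in> SG 2 \<longleftrightarrow> (\<exists>e>0. (a, b) \<in> gap_pairs e)"
proof -
  let ?P = "\<lambda>e v. e * L2_norm v \<le> L2_norm (\<lambda>h. left_reg a v h - v h) \<or>
    e * L2_norm v \<le> L2_norm (\<lambda>h. left_reg b v h - v h)"
  have sq: "?P e v \<longleftrightarrow> e\<^sup>2 * L2sq v \<le> max (displacement a v) (displacement b v)" if "e > 0" for e v
  proof -
    have "e * sqrt (L2sq v) = sqrt (e\<^sup>2 * L2sq v)" using that by (simp add: real_sqrt_mult)
    then show ?thesis by (simp add: L2_norm_L2sq displacement_def le_max_iff_disj)
  qed
  have "spectral_gap [a, b] \<longleftrightarrow> (\<exists>e>0. \<forall>v\<in>L2_0. ?P e v)"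
    by (simp add: spectral_gap_def less_Suc_eq numeral_2_eq_2 ex_disj_distrib conj_disj_distribR)
  also have "\<dots> \<longleftrightarrow> (\<exists>e>0. \<forall>v\<in>L2_0. e\<^sup>2 * L2sq v \<le> max (displacement a v) (displacement b v))"
    by (intro ex_cong1 conj_cong refl ball_cong sq)
  also have "\<dots> \<longleftrightarrow> (\<exists>e>0. \<forall>v\<in>L2_0. e * L2sq v \<le> max (displacement a v) (displacement b v))"
    (is "(\<exists>e>0. ?R (e\<^sup>2)) \<longleftrightarrow> (\<exists>e>0. ?R e)")
  proof
    assume "\<exists>e>0. ?R (e\<^sup>2)"
    then obtain e where "e > 0" "?R (e\<^sup>2)" by blast
    then show "\<exists>e>0. ?R e" by (intro exI[of _ "e\<^sup>2"]) simp
  next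
    assume "\<exists>e>0. ?R e"
    then obtain e where "e > 0" "?R e" by blast
    then show "\<exists>e>0. ?R (e\<^sup>2)" by (intro exI[of _ "sqrt e"]) simp
  qed
  finally show ?thesis by (auto simp: SG_def gap_pairs_def)
qed

text \<open>Induction over the word through the cocycle estimate; each product turns constants
  \<open>C\<close>, \<open>D\<close> into \<open>2 * C + 2 * D\<close>. What matters is that the
  constant is independent of the vector.\<close>

lemma words_displacement:
  assumes "w \<in> words"
  shows "\<exists>C>0. \<forall>p\<in>SU2 \<times> SU2. \<forall>v\<in>L2.
    displacement (w p) v \<le> C * max (displacement (fst p) v) (displacement (snd p) v)"
  using assms
proof induction
  case (3 w z)
  then obtain C D where C: "C > 0" "D > 0"
    "\<And>p v. p \<in> SU2 \<times> SU2 \<Longrightarrow> v \<in> L2 \<Longrightarrow>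
      displacement (w p) v \<le> C * max (displacement (fst p) v) (displacement (snd p) v)"
    "\<And>p v. p \<in> SU2 \<times> SU2 \<Longrightarrow> v \<in> L2 \<Longrightarrow>
      displacement (z p) v \<le> D * max (displacement (fst p) v) (displacement (snd p) v)"
    by blast
  have "displacement (w p ** z p) v \<le> (2 * C + 2 * D) * max (displacement (fst p) v) (displacement (snd p) v)"
    if "p \<in> SU2 \<times> SU2" "v \<in> L2" for p v
    using C(3,4)[OF that] L2sq_left_reg_mult_le[OF words_SU2[OF 3(1) that(1)] words_SU2[OF 3(2) that(1)] that(2)]
    by (simp add: displacement_def algebra_simps)
  then show ?case using C(1,2) by (intro exI[of _ "2 * C + 2 * D"]) auto
qed (auto intro!: exI[of _ 1])

text \<open>If both words move \<open>v\<close> by at most a multiple of what the pair does, a gap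
  for the words forces one for the pair. The sum \<open>C + D\<close> dominates both
  multiples.\<close>

lemma gap_pairs_of_words:
  assumes w: "w \<in> words" "z \<in> words" and p: "p \<in> SU2 \<times> SU2"
    and gap: "(w p, z p) \<in> gap_pairs e" and e: "e > 0"
  shows "\<exists>e'>0. p \<in> gap_pairs e'"
proof -
  obtain C D where C: "C > 0" "D > 0"
    "\<And>v. v \<in> L2 \<Longrightarrow> displacement (w p) v \<le> C * max (displacement (fst p) v) (displacement (snd p) v)"
    "\<And>v. v \<in> L2 \<Longrightarrow> displacement (z p) v \<le> D * max (displacement (fst p) v) (displacement (snd p) v)"
    using words_displacement[OF w(1)] words_displacement[OF w(2)] p by blast
  have "e / (C + D) * L2sq v \<le> max (displacement (fst p) v) (displacement (snd p) v)" if v: "v \<in> L2_0" for v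
  proof -
    let ?m = "max (displacement (fst p) v) (displacement (snd p) v)"
    have "0 \<le> ?m" by (simp add: displacement_nonneg le_max_iff_disj)
    then have "C * ?m \<le> (C + D) * ?m" "D * ?m \<le> (C + D) * ?m"
      using C(1,2) by (auto intro: mult_right_mono)
    moreover have "e * L2sq v \<le> max (displacement (w p) v) (displacement (z p) v)"
      using gap v by (simp add: gap_pairs_def)
    ultimately have "e * L2sq v \<le> (C + D) * ?m"
      using C(3,4)[OF L2_0_L2[OF v]] by linarith
    then show ?thesis using C(1,2) by (simp add: field_simps)
  qed
  then show ?thesis
    using p e C(1,2) by (intro exI[of _ "e / (C + D)"]) (simp add: gap_pairs_def)
qed

lemma displacement_perturb:
  assumes "v \<in> L2" "g \<in> SU2" "k \<in> SU2"
  shows "displacement k v \<le> 2 * L2sq (\<lambda>h. left_reg k v h - left_reg g v h) + 2 * displacement g v"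
proof -
  have "L2sq (\<lambda>h. (left_reg k v h - left_reg g v h) + (left_reg g v h - v h))
    \<le> 2 * L2sq (\<lambda>h. left_reg k v h - left_reg g v h) + 2 * L2sq (\<lambda>h. left_reg g v h - v h)"
    using assms by (intro L2sq_add_le L2_diff left_reg_L2)
  then show ?thesis by (simp add: displacement_def)
qed

text \<open>For fixed \<open>v\<close>, a pair of \<open>gap_pairs e\<close> close enough to
  \<open>p\<close> changes each displacement by a controlled amount. With \<open>\<eta>\<close>
  equal to a quarter of \<open>e * L2sq v\<close>, the estimate
  \<open>e * L2sq v \<le> 2 * \<eta> + 2 * m\<close>, where \<open>m\<close> is the larger
  displacement at \<open>p\<close>, leaves exactly the factor 1/4.\<close>

lemma closure_gap_pairs:
  assumes e: "e > 0"
  shows "top_of_set (SU2 \<times> SU2) closure_of gap_pairs e \<subseteq> gap_pairs (e / 4)"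
proof
  fix p assume p: "p \<in> top_of_set (SU2 \<times> SU2) closure_of gap_pairs e"
  obtain a b where ab: "p = (a, b)" by (cases p)
  have SU: "a \<in> SU2" "b \<in> SU2" using p by (auto simp: in_closure_of ab)
  have "e / 4 * L2sq v \<le> max (displacement a v) (displacement b v)" if v: "v \<in> L2_0" for v
  \<comment> \<open>Null vectors are split off because the tolerance \<open>\<eta>\<close> has to be
    positive.\<close>
  proof (cases "L2sq v = 0")
    case True
    then show ?thesis by (simp add: displacement_nonneg le_max_iff_disj)
  next
    case False
    define \<eta> where "\<eta> = e / 4 * L2sq v"
    have "L2sq v > 0" using False L2sq_nonneg[of v] by linarith
    then have \<eta>: "\<eta> > 0" using e by (simp add: \<eta>_def)
    note vL2 = L2_0_L2[OF v]
    obtain d where d: "d > 0"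
      "\<And>g. g \<in> SU2 \<Longrightarrow> dist g a < d \<Longrightarrow> L2sq (\<lambda>h. left_reg g v h - left_reg a v h) < \<eta>"
      using left_reg_strongly_continuous[OF vL2 SU(1) \<eta>] by blast
    obtain d' where d': "d' > 0"
      "\<And>g. g \<in> SU2 \<Longrightarrow> dist g b < d' \<Longrightarrow> L2sq (\<lambda>h. left_reg g v h - left_reg b v h) < \<eta>"
      using left_reg_strongly_continuous[OF vL2 SU(2) \<eta>] by blast
    let ?N = "(SU2 \<times> SU2) \<inter> (ball a d \<times> ball b d')"
    have N: "openin (top_of_set (SU2 \<times> SU2)) ?N"
      by (intro openin_open_Int open_Times open_ball)
    have "(a, b) \<in> ?N" using SU d d' by simp
    from p[unfolded in_closure_of ab, THEN conjunct2, rule_format, OF conjI, OF this N]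
    obtain q where "q \<in> gap_pairs e" "q \<in> ?N"
      by blast
    then obtain a' b' where q: "(a', b') \<in> gap_pairs e" "a' \<in> SU2" "b' \<in> SU2" "dist a' a < d" "dist b' b < d'"
      by (cases q) (auto simp: dist_commute)
    have "e * L2sq v \<le> max (displacement a' v) (displacement b' v)"
      using q(1) v by (simp add: gap_pairs_def)
    moreover have "displacement a' v \<le> 2 * \<eta> + 2 * displacement a v"
      using displacement_perturb[OF vL2 SU(1) q(2)] d(2)[OF q(2,4)] by linarith
    moreover have "displacement b' v \<le> 2 * \<eta> + 2 * displacement b v"
      using displacement_perturb[OF vL2 SU(2) q(3)] d'(2)[OF q(3,5)] by linarith
    ultimately show ?thesis unfolding \<eta>_def by linarith
  qed
  then show "p \<in> gap_pairs (e / 4)" using SU by (simp add: gap_pairs_def ab)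
qed

text \<open>Shrink \<open>U\<close> to a product of open sets. Any neighbourhood of \<open>p\<close>
  contains a pair whose words are dense in \<open>SU2\<close>, and one word for each factor then
  lands in the product.\<close>

lemma dense_words_preimage:
  assumes U: "openin (top_of_set (SU2 \<times> SU2)) U" "U \<noteq> {}"
  shows "top_of_set (SU2 \<times> SU2) closure_of {p \<in> SU2 \<times> SU2. \<exists>w\<in>words. \<exists>z\<in>words. (w p, z p) \<in> U}
    = SU2 \<times> SU2"
proof (intro equalityI subsetI)
  fix p assume p: "p \<in> SU2 \<times> SU2"
  obtain a0 b0 where p_eq: "p = (a0, b0)" by (cases p)
  obtain c d where cd: "(c, d) \<in> U" using U(2) by auto
  obtain O' where O': "open O'" "U = (SU2 \<times> SU2) \<inter> O'" using U(1) by (auto simp: openin_open)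
  obtain C D where CD: "open C" "open D" "c \<in> C" "d \<in> D" "C \<times> D \<subseteq> O'"
    by (rule open_prod_elim[OF O'(1), of "(c, d)"]) (use cd O'(2) in blast)+
  show "p \<in> top_of_set (SU2 \<times> SU2) closure_of {p \<in> SU2 \<times> SU2. \<exists>w\<in>words. \<exists>z\<in>words. (w p, z p) \<in> U}"
    unfolding in_closure_of
  proof (intro conjI allI impI)
    show "p \<in> topspace (top_of_set (SU2 \<times> SU2))" using p by simp
    fix T assume "p \<in> T \<and> openin (top_of_set (SU2 \<times> SU2)) T"
    then have T: "p \<in> T" "openin (top_of_set (SU2 \<times> SU2)) T" by blast+
    obtain T' where T': "open T'" "T = (SU2 \<times> SU2) \<inter> T'" using T(2) by (auto simp: openin_open)
    obtain A B where AB: "open A" "open B" "a0 \<in> A" "b0 \<in> B" "A \<times> B \<subseteq> T'"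
      by (rule open_prod_elim[OF T'(1), of "(a0, b0)"]) (use T T'(2) p_eq in blast)+
    obtain a b where ab: "a \<in> SU2" "a \<in> A" "b \<in> SU2" "b \<in> B"
      and dense: "SU2 \<subseteq> closure ((\<lambda>w. w (a, b)) ` words)"
      using topologically_generating_pairs_dense[of a0 A b0 B] p p_eq AB by auto
    let ?G = "(\<lambda>w. w (a, b)) ` words"
    have "c \<in> C \<inter> closure ?G" "d \<in> D \<inter> closure ?G"
      using dense cd O'(2) CD by auto
    then have "C \<inter> ?G \<noteq> {}" "D \<inter> ?G \<noteq> {}"
      using open_Int_closure_eq_empty[OF CD(1), of ?G] open_Int_closure_eq_empty[OF CD(2), of ?G] by auto
    then obtain w z where wz: "w \<in> words" "w (a, b) \<in> C" "z \<in> words" "z (a, b) \<in> D"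
      by auto
    have "(w (a, b), z (a, b)) \<in> U"
      using wz CD ab by (auto simp: O'(2) words_SU2)
    moreover have "(a, b) \<in> T" using ab AB T'(2) by auto
    ultimately show "\<exists>y. y \<in> {p \<in> SU2 \<times> SU2. \<exists>w\<in>words. \<exists>z\<in>words. (w p, z p) \<in> U} \<and> y \<in> T"
      using ab wz by blast
  qed
qed (auto simp: in_closure_of)

lemma openin_words_preimage:
  assumes U: "openin (top_of_set (SU2 \<times> SU2)) U"
  shows "openin (top_of_set (SU2 \<times> SU2)) {p \<in> SU2 \<times> SU2. \<exists>w\<in>words. \<exists>z\<in>words. (w p, z p) \<in> U}"
proof -
  have "openin (top_of_set (SU2 \<times> SU2)) ((SU2 \<times> SU2) \<inter> (\<lambda>p. (w p, z p)) -` U)"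
    if "w \<in> words" "z \<in> words" for w z
    by (rule continuous_openin_preimage[OF _ _ U])
       (use that words_SU2 in \<open>auto intro!: continuous_on_Pair words_continuous\<close>)
  then have "openin (top_of_set (SU2 \<times> SU2))
      (\<Union>{(SU2 \<times> SU2) \<inter> (\<lambda>p. (w p, z p)) -` U | w z. w \<in> words \<and> z \<in> words})"
    by (intro openin_Union) auto
  also have "\<Union>{(SU2 \<times> SU2) \<inter> (\<lambda>p. (w p, z p)) -` U | w z. w \<in> words \<and> z \<in> words}
      = {p \<in> SU2 \<times> SU2. \<exists>w\<in>words. \<exists>z\<in>words. (w p, z p) \<in> U}" by blast
  finally show ?thesis .
qed

theorem theorem1p2:
  defines "SG2 \<equiv> {(a, b). [a, b] \<in> SG 2}"
  shows "meager_in (top_of_set (SU2 \<times> SU2)) SG2 \<or>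
         comeager_in (top_of_set (SU2 \<times> SU2)) SG2"
proof -
  let ?X = "top_of_set (SU2 \<times> SU2)"
  have SG2: "p \<in> SG2 \<longleftrightarrow> (\<exists>e>0. p \<in> gap_pairs e)" for p
    unfolding SG2_def by (cases p) (simp add: SG_2_iff)
  then have sub: "SG2 \<subseteq> topspace ?X" by (auto simp: gap_pairs_def)
  show ?thesis
  \<comment> \<open>The sets \<open>gap_pairs e\<close> grow as \<open>e\<close> decreases, so the
    countably many constants 1/(n+1) exhaust all of them.\<close>
  proof (cases "\<forall>n. nowhere_dense_in ?X (gap_pairs (1 / real (Suc n)))")
    case True
    have "SG2 \<subseteq> (\<Union>n. gap_pairs (1 / real (Suc n)))"
    proof
      fix p assume "p \<in> SG2"
      then obtain e where e: "e > 0" "p \<in> gap_pairs e" using SG2 by blast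
      obtain n where n: "1 / real (Suc n) < e" using nat_approx_posE[OF e(1)] .
      have "1 / real (Suc n) * L2sq v \<le> e * L2sq v" for v
        using n by (intro mult_right_mono) auto
      then have "p \<in> gap_pairs (1 / real (Suc n))"
        using e(2) unfolding gap_pairs_def by (blast intro: order_trans)
      then show "p \<in> (\<Union>n. gap_pairs (1 / real (Suc n)))" by blast
    qed
    then have "meager_in ?X SG2"
      unfolding meager_in_def using sub True
      by (intro conjI exI[of _ "range (\<lambda>n. gap_pairs (1 / real (Suc n)))"]) auto
    then show ?thesis ..
  next
    case False
    then obtain e where e: "e > 0" "\<not> nowhere_dense_in ?X (gap_pairs e)"
      by (metis of_nat_0_less_iff zero_less_Suc zero_less_divide_1_iff)
    define U where "U = ?X interior_of (?X closure_of gap_pairs e)"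
    have U: "openin ?X U" "U \<noteq> {}"
      using e(2) by (auto simp: U_def nowhere_dense_in_def gap_pairs_def)
    have U_gap: "U \<subseteq> gap_pairs (e / 4)"
      using closure_gap_pairs[OF e(1)] interior_of_subset unfolding U_def by (rule order_trans[rotated])
    define V where "V = {p \<in> SU2 \<times> SU2. \<exists>w\<in>words. \<exists>z\<in>words. (w p, z p) \<in> U}"
    have "V \<subseteq> SG2"
    proof
      fix p assume "p \<in> V"
      then obtain w z where "w \<in> words" "z \<in> words" "p \<in> SU2 \<times> SU2" "(w p, z p) \<in> gap_pairs (e / 4)"
        using U_gap by (auto simp: V_def)
      then show "p \<in> SG2" using gap_pairs_of_words[of w z p "e / 4"] e(1) by (simp add: SG2)
    qed
    \<comment> \<open>The complement of an open dense set is closed with empty interior, so this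
      single set witnesses meagerness of the complement of \<open>SG2\<close>.\<close>
    moreover have "nowhere_dense_in ?X (topspace ?X - V)"
    proof -
      have "?X closure_of V = topspace ?X" using dense_words_preimage[OF U] by (simp add: V_def)
      then have "?X interior_of (topspace ?X - V) = {}"
        unfolding interior_of_complement by simp
      moreover have "openin ?X V" using openin_words_preimage[OF U(1)] by (simp add: V_def)
      then have "?X closure_of (topspace ?X - V) = topspace ?X - V"
        by (intro closure_of_closedin closedin_diff) auto
      ultimately show ?thesis
        by (simp add: nowhere_dense_in_def)
    qed
    ultimately have "meager_in ?X (topspace ?X - SG2)"
      unfolding meager_in_def by (intro conjI exI[of _ "{topspace ?X - V}"]) auto
    then show ?thesis using sub by (simp add: comeager_in_def)
  qed
qed

end
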